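(* Suppose that $W_0\in\mathcal{A}_1$ and $W_1\in\mathcal{A}_\infty$ are matrix weights on $\mathbb{R}^n$ with values in $d\times d$ matrices, and $1<p<\infty$. Then $$\bar W=\big((W_0)^2\,\#_{1/p'}\,(W_1)^2\big)^{1/2}\in\mathcal{A}_p .$$ In particular, if $W_0$ and $W_1$ commute, then $W_0^{1/p}W_1^{1/p'}\in\mathcal{A}_p$.
   Context: For symmetric positive definite matrices $A,B$ and $0<t<1$, the weighted geometric mean is $A\#_tB=A^{1/2}(A^{-1/2}BA^{-1/2})^tA^{1/2}$; for matrix weights it and powers are taken pointwise. A matrix weight is a measurable map $W$ from $\mathbb{R}^n$ into the $d\times d$ real symmetric positive semidefinite matrices that is positive definite a.e. Cubes $Q$ have sides parallel to the axes; $|\cdot|_{\mathrm{op}}$ is the operator norm; $1/p+1/p'=1$. For $1<p<\infty$, $W\in\mathcal{A}_p$ means $$[W]_{\mathcal{A}_p}=\sup_Q\Big(\frac{1}{|Q|}\int_Q\Big(\frac{1}{|Q|}\int_Q|W(x)W^{-1}(y)|_{\mathrm{op}}^{p'}\,dy\Big)^{p/p'}dx\Big)^{1/p}<\infty .$$ $W\in\mathcal{A}_1$ means $[W]_{\mathcal{A}_1}=\sup_Q\operatorname{ess\,sup}_{x\in Q}\frac{1}{|Q|}\int_Q|W^{-1}(x)W(y)|_{\mathrm{op}}\,dy<\infty$, and $W\in\mathcal{A}_\infty$ means $[W]_{\mathcal{A}_\infty}=\sup_Q\operatorname{ess\,sup}_{x\in Q}\frac{1}{|Q|}\int_Q|W(x)W^{-1}(y)|_{\mathrm{op}}\,dy<\infty$.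 *)

theory Defs
  imports "HOL-Analysis.Analysis" "HOL-Probability.Essential_Supremum"
begin

section \<open>Symmetric matrices, real powers, geometric means\<close>

definition pos_semidef :: "real^'d^'d \<Rightarrow> bool" where
  "pos_semidef A \<longleftrightarrow> transpose A = A \<and> (\<forall>v. 0 \<le> v \<bullet> (A *v v))"

definition pos_def :: "real^'d^'d \<Rightarrow> bool" where
  "pos_def A \<longleftrightarrow> transpose A = A \<and> (\<forall>v. v \<noteq> 0 \<longrightarrow> 0 < v \<bullet> (A *v v))"

definition op_norm :: "real^'d^'d \<Rightarrow> real" where
  "op_norm A = onorm ((*v) A)"

definition diag :: "real^'d \<Rightarrow> real^'d^'d" where
  "diag l = (\<chi> i j. if i = j then l $ i else 0)"

text \<open>The power \<open>A\<^sup>t\<close> of a positive semidefinite \<open>A\<close>: in an orthonormal eigenbasis, raise the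
  eigenvalues to the power \<open>t\<close>. The lemma below shows that the result does not depend on the
  diagonalization. As \<open>0 powr t = 0\<close>, negative powers of a singular matrix
  are the powers of its pseudoinverse.\<close>

definition mat_powr :: "real^'d^'d \<Rightarrow> real \<Rightarrow> real^'d^'d" where
  "mat_powr A t = (THE B. \<exists>U l. orthogonal_matrix U \<and>
     A = U ** diag l ** transpose U \<and>
     B = U ** diag (\<chi> i. l $ i powr t) ** transpose U)"

lemma mat_powr_diagonalization:
  fixes U :: "real^'d^'d"
  assumes U: "orthogonal_matrix U"
  shows "mat_powr (U ** diag l ** transpose U) t
    = U ** diag (\<chi> i. l $ i powr t) ** transpose U"
proof -
  have diagR: "(M ** diag k) $ i $ j = M $ i $ j * k $ j" for M :: "real^'d^'d" and k i j
    by (simp add: matrix_matrix_mult_def diag_def if_distrib [of "(*) _"] cong: if_cong)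
  have diagL: "(diag k ** M) $ i $ j = k $ i * M $ i $ j" for M :: "real^'d^'d" and k i j
    by (simp add: matrix_matrix_mult_def diag_def if_distrib [of "\<lambda>x. x * _"] cong: if_cong)
  have uniq: "V ** diag (\<chi> i. k $ i powr t) ** transpose V
      = U ** diag (\<chi> i. l $ i powr t) ** transpose U"
    if V: "orthogonal_matrix V"
      and eq: "U ** diag l ** transpose U = V ** diag k ** transpose V"
    for V :: "real^'d^'d" and k
  proof -
    define M where "M = transpose V ** U"
    have oV: "transpose V ** V = mat 1" "V ** transpose V = mat 1"
      and oU: "transpose U ** U = mat 1" "U ** transpose U = mat 1"
      using U V by (auto simp: orthogonal_matrix_def)
    have "M ** diag l = transpose V ** (U ** diag l ** transpose U) ** U"
      unfolding M_def by (metis matrix_mul_assoc matrix_mul_rid oU(1))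
    also have "\<dots> = transpose V ** (V ** diag k ** transpose V) ** U"
      using eq by simp
    also have "\<dots> = diag k ** M"
      unfolding M_def by (metis matrix_mul_assoc matrix_mul_lid oV(1))
    finally have comm: "M ** diag l = diag k ** M" .
    have "M $ i $ j * l $ j = k $ i * M $ i $ j" for i j
      using comm by (metis diagL diagR)
    then have "M $ i $ j * l $ j powr t = k $ i powr t * M $ i $ j" for i j
      by (metis mult.commute mult_cancel_right)
    then have "M ** diag (\<chi> i. l $ i powr t) = diag (\<chi> i. k $ i powr t) ** M"
      by (simp add: vec_eq_iff diagL diagR)
    then have "V ** (M ** diag (\<chi> i. l $ i powr t)) ** transpose U
        = V ** (diag (\<chi> i. k $ i powr t) ** M) ** transpose U"
      by simp
    moreover have "V ** (M ** D) ** transpose U = U ** D ** transpose U" for D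
      unfolding M_def by (metis matrix_mul_assoc matrix_mul_lid oV(2))
    moreover have "V ** (D ** M) ** transpose U = V ** D ** transpose V" for D
      unfolding M_def by (metis matrix_mul_assoc matrix_mul_rid oU(2))
    ultimately show ?thesis by simp
  qed
  show ?thesis
    unfolding mat_powr_def by (rule the_equality) (use U uniq in blast)+
qed

definition geom_mean :: "real \<Rightarrow> real^'d^'d \<Rightarrow> real^'d^'d \<Rightarrow> real^'d^'d" where
  "geom_mean t A B = mat_powr A (1/2) **
     mat_powr (mat_powr A (-1/2) ** B ** mat_powr A (-1/2)) t ** mat_powr A (1/2)"

section \<open>Matrix weights and the Muckenhoupt classes\<close>

definition conj_exp :: "real \<Rightarrow> real" where
  "conj_exp p = p / (p - 1)"

lemma conj_exp: "1 < p \<Longrightarrow> 1 / p + 1 / conj_exp p = 1"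
  by (simp add: conj_exp_def field_simps)

text \<open>Used for positive exponents only, so that \<open>\<infinity>\<^sup>r = \<infinity>\<close>.\<close>

definition enn_powr :: "ennreal \<Rightarrow> real \<Rightarrow> ennreal" where
  "enn_powr x r = (if x = \<infinity> then \<infinity> else ennreal (enn2real x powr r))"

definition cubes :: "(real^'n) set set" where
  "cubes = {cbox a (\<chi> i. a $ i + s) |a s. 0 < s}"

definition average :: "(real^'n) set \<Rightarrow> (real^'n \<Rightarrow> ennreal) \<Rightarrow> ennreal" where
  "average Q f = (\<integral>\<^sup>+x\<in>Q. f x \<partial>lebesgue) / emeasure lebesgue Q"

definition matrix_weight :: "(real^'n \<Rightarrow> real^'d^'d) \<Rightarrow> bool" where
  "matrix_weight W \<longleftrightarrow> W \<in> borel_measurable lebesgue \<and>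
     (\<forall>x. pos_semidef (W x)) \<and> (AE x in lebesgue. pos_def (W x))"

definition Ap_const :: "real \<Rightarrow> (real^'n \<Rightarrow> real^'d^'d) \<Rightarrow> ennreal" where
  "Ap_const p W = (SUP Q\<in>cubes. enn_powr
     (average Q (\<lambda>x. enn_powr
        (average Q (\<lambda>y. ennreal (op_norm (W x ** matrix_inv (W y)) powr conj_exp p)))
        (p / conj_exp p)))
     (1 / p))"

definition A1_const :: "(real^'n \<Rightarrow> real^'d^'d) \<Rightarrow> ennreal" where
  "A1_const W = (SUP Q\<in>cubes. esssup (lebesgue_on Q)
     (\<lambda>x. average Q (\<lambda>y. ennreal (op_norm (matrix_inv (W x) ** W y)))))"

definition Ainf_const :: "(real^'n \<Rightarrow> real^'d^'d) \<Rightarrow> ennreal" where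
  "Ainf_const W = (SUP Q\<in>cubes. esssup (lebesgue_on Q)
     (\<lambda>x. average Q (\<lambda>y. ennreal (op_norm (W x ** matrix_inv (W y))))))"

definition class_Ap :: "real \<Rightarrow> (real^'n \<Rightarrow> real^'d^'d) set" where
  "class_Ap p = {W. matrix_weight W \<and> Ap_const p W < \<infinity>}"

definition class_A1 :: "(real^'n \<Rightarrow> real^'d^'d) set" where
  "class_A1 = {W. matrix_weight W \<and> A1_const W < \<infinity>}"

definition class_Ainf :: "(real^'n \<Rightarrow> real^'d^'d) set" where
  "class_Ainf = {W. matrix_weight W \<and> Ainf_const W < \<infinity>}"

end

(*
  Write t = 1/p' and let V be the weight in question, so that |V v|^2 is the quadratic form of
  W0^2 #_t W1^2. Simultaneously diagonalizing W0^2 and W1^2 by a congruence turns the geometric mean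
  into a weighted average of quadratic K-functionals of the pair, which are monotone in both
  matrices. Hence the interpolation bound
    |V(x) V(y)^-1| <= |W0(x) W0(y)^-1|^(1/p) |W1(x) W1(y)^-1|^(1/p').
  An Auerbach basis E of the norm v |-> average of |W0 v| over Q, together with the A_1 condition,
  gives |W0(x) W0(y)^-1| <= d [W0] |W0(x) E| (up to replacing the operator norm of W0(x) E by the sum
  of its column norms) for almost every y in Q, and the average of the right-hand side over x is at
  most d^2 [W0]. The A_infinity condition bounds the average over y of |W1(x) W1(y)^-1|.
  If W0 and W1 commute, they are simultaneously orthogonally diagonalizable and V is W0^(1/p) W1^(1/p')
  everywhere.
*)
theory Submission
  imports Defs
begin

section \<open>Simultaneous diagonalization of symmetric matrices\<close>

text \<open>The obstacle is non-commutativity: V(x) V(y)^-1 does not split into W0(x) W0(y)^-1 and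
  W1(x) W1(y)^-1, and the geometric means at x and y are diagonal in unrelated coordinates. What
  survives is order: the operator norm of X Y^-1 is the least k with |X v| <= k |Y v| for all v, so
  the interpolation bound compares quadratic forms, and the squares in V supply these forms. The
  exponents then fit. The p'-th power of the interpolation bound is a^(p'/p) b, with a from W0 and b
  from W1. The average over y meets b to the first power, as the A_infinity condition wants, but a
  depends on y too, and the A_1 condition only controls averages over x at fixed y. The reducing
  matrix replaces a by a majorant in x alone; it leaves the inner average and returns to the first
  power under the outer exponent p/p'. The result is [V] <= (d^2 [W0])^(1/p) [W1]^(1/p'). Functions
  built from matrix inverses are integrated without measurability claims: only monotonicity and
  scaling by constants are applied to them.\<close>

lemma inner_matrix_vector: "x \<bullet> (A *v y) = (transpose A *v x) \<bullet> y" for A :: "real^'n^'m"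
  by (metis dot_lmul_matrix vector_transpose_matrix transpose_transpose)

lemma inner_symmetric_matrix:
  "transpose A = A \<Longrightarrow> x \<bullet> (A *v y) = (A *v x) \<bullet> y" for A :: "real^'d^'d"
  by (simp add: inner_matrix_vector)

text \<open>A maximizer \<open>v\<close> of the Rayleigh quotient on the unit sphere of
  \<open>S\<close> is an eigenvector: the form \<open>Q\<close> is nonnegative on \<open>S\<close>
  and vanishes at \<open>v\<close>, so its gradient there must vanish. Working inside an invariant
  subspace allows the induction on dimension below.\<close>

lemma symmetric_has_eigenvector:
  fixes A :: "real^'d^'d"
  assumes sym: "transpose A = A" and S: "subspace S" "S \<noteq> {0}"
    and inv: "\<And>x. x \<in> S \<Longrightarrow> A *v x \<in> S"
  obtains v c where "v \<in> S" "norm v = 1" "A *v v = c *\<^sub>R v"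
proof -
  let ?K = "S \<inter> sphere 0 1"
  obtain x where x: "x \<in> S" "x \<noteq> 0" using S subspace_0 by blast
  have "(1 / norm x) *\<^sub>R x \<in> ?K" using x S by (auto simp: subspace_scale)
  moreover have "compact ?K"
    by (intro closed_Int_compact closed_subspace S) auto
  moreover have "continuous_on ?K (\<lambda>v. v \<bullet> (A *v v))"
    by (intro continuous_on_inner continuous_on_id linear_continuous_on) simp
  ultimately obtain v where v: "v \<in> ?K" and max: "\<And>w. w \<in> ?K \<Longrightarrow> w \<bullet> (A *v w) \<le> v \<bullet> (A *v v)"
    using continuous_attains_sup[of ?K "\<lambda>v. v \<bullet> (A *v v)"] by blast
  define c where "c = v \<bullet> (A *v v)"
  define Q where "Q w = c * (w \<bullet> w) - w \<bullet> (A *v w)" for w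
  have Q: "Q w \<ge> 0" if "w \<in> S" for w
  proof (cases "w = 0")
    case False
    let ?u = "(1 / norm w) *\<^sub>R w"
    have "?u \<in> ?K" using that S False by (auto simp: subspace_scale)
    from max[OF this] have "(w \<bullet> (A *v w)) / (norm w)\<^sup>2 \<le> c"
      by (simp add: c_def matrix_vector_mult_scaleR power2_eq_square)
    then show ?thesis
      using False by (simp add: Q_def divide_le_eq power2_norm_eq_inner)
  qed (simp add: Q_def)
  \<comment> \<open>Half the gradient of \<open>Q\<close> at \<open>v\<close>; it lies in
    \<open>S\<close> by invariance, so moving from \<open>v\<close> in the direction
    \<open>- w\<close> stays in \<open>S\<close>.\<close>
  define w where "w = c *\<^sub>R v - A *v v"
  have wS: "w \<in> S" using v inv S by (auto simp: w_def intro!: subspace_diff subspace_scale)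
  have vv: "v \<bullet> v = 1" using v by (simp add: norm_eq_1)
  have expand: "Q (v - e *\<^sub>R w) = - 2 * e * (w \<bullet> w) + e\<^sup>2 * Q w" for e
  proof -
    have "v \<bullet> (A *v w) = w \<bullet> (A *v v)"
      using sym inner_symmetric_matrix by (metis inner_commute)
    moreover have "w \<bullet> w = c * (w \<bullet> v) - w \<bullet> (A *v v)"
      by (subst (2) w_def) (simp add: inner_diff_right)
    then have "e * (w \<bullet> w) = e * (c * (w \<bullet> v) - w \<bullet> (A *v v))" by simp
    moreover have "Q (v - e *\<^sub>R w) = c * (1 - 2 * e * (v \<bullet> w) + e * e * (w \<bullet> w))
        - (c - e * (v \<bullet> (A *v w)) - e * (w \<bullet> (A *v v)) + e * e * (w \<bullet> (A *v w)))"
      by (simp add: Q_def c_def matrix_vector_mult_diff_distrib matrix_vector_mult_scaleR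
        inner_diff_left inner_diff_right inner_commute[of w v] vv algebra_simps)
    ultimately show ?thesis
      by (simp add: Q_def power2_eq_square inner_commute[of w v] algebra_simps)
  qed
  have "w \<bullet> w \<le> 0"
  proof (rule ccontr)
    assume "\<not> ?thesis"
    then have pos: "w \<bullet> w > 0" by linarith
    \<comment> \<open>So small a step that the quadratic term \<open>e^2 * Q w\<close> cannot
      compensate the linear gain; the \<open>+ 1\<close> covers \<open>Q w = 0\<close>.\<close>
    define e where "e = (w \<bullet> w) / (Q w + 1)"
    have Qw: "Q w \<ge> 0" using Q wS by blast
    have e: "e > 0" using pos Qw by (simp add: e_def)
    have "0 \<le> Q (v - e *\<^sub>R w)" using v wS S by (intro Q subspace_diff subspace_scale) auto
    then have "2 * e * (w \<bullet> w) \<le> e * (e * Q w)" by (simp add: expand power2_eq_square mult.assoc)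
    then have "2 * (w \<bullet> w) \<le> e * Q w" using e by (simp add: mult.assoc)
    also have "\<dots> \<le> w \<bullet> w" using Qw pos
      by (simp add: e_def divide_le_eq algebra_simps)
    finally show False using pos by simp
  qed
  then have "w = 0" by (metis inner_eq_zero_iff inner_ge_zero order_antisym)
  then show thesis using that[of v c] v by (auto simp: w_def)
qed

text \<open>An eigenspace of \<open>A\<close> in \<open>S\<close> is invariant under
  \<open>B\<close> because the two commute, so \<open>B\<close> has an eigenvector in it: a common
  eigenvector. Its orthogonal complement in \<open>S\<close> is invariant by symmetry and has
  smaller dimension.\<close>

lemma commuting_symmetric_orthonormal_eigenbasis:
  fixes A B :: "real^'d^'d"
  assumes sym: "transpose A = A" "transpose B = B" and comm: "A ** B = B ** A"
    and S: "subspace S"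
    and inv: "\<And>x. x \<in> S \<Longrightarrow> A *v x \<in> S" "\<And>x. x \<in> S \<Longrightarrow> B *v x \<in> S"
  shows "\<exists>T. T \<subseteq> S \<and> S \<subseteq> span T \<and> pairwise orthogonal T \<and>
    (\<forall>x\<in>T. norm x = 1 \<and> (\<exists>c. A *v x = c *\<^sub>R x) \<and> (\<exists>c. B *v x = c *\<^sub>R x))"
  using S inv
proof (induction "dim S" arbitrary: S rule: less_induct)
  case less
  show ?case
  proof (cases "S = {0}")
    case True
    then show ?thesis by (intro exI[of _ "{}"]) auto
  next
    case False
    obtain v0 a where v0: "v0 \<in> S" "norm v0 = 1" "A *v v0 = a *\<^sub>R v0"
      using symmetric_has_eigenvector[OF sym(1) less.prems(1) False less.prems(2)] by blast
    let ?E = "{x \<in> S. A *v x = a *\<^sub>R x}"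
    have "subspace ?E"
      using less.prems(1) by (auto simp: subspace_def matrix_vector_right_distrib
        matrix_vector_mult_scaleR scaleR_right_distrib)
    moreover have "?E \<noteq> {0}"
    proof -
      have "v0 \<in> ?E" "v0 \<noteq> 0" using v0 by auto
      then show ?thesis by blast
    qed
    moreover have "B *v x \<in> ?E" if "x \<in> ?E" for x
    proof -
      have "A *v (B *v x) = B *v (A *v x)"
        by (simp only: matrix_vector_mul_assoc comm)
      then show ?thesis using that less.prems(3) by (simp add: matrix_vector_mult_scaleR)
    qed
    ultimately obtain v b where v: "v \<in> ?E" "norm v = 1" "B *v v = b *\<^sub>R v"
      using symmetric_has_eigenvector[OF sym(2), of ?E] by blast
    define S' where "S' = {x \<in> S. v \<bullet> x = 0}"
    have subS': "subspace S'"
      using less.prems(1) by (auto simp: subspace_def S'_def inner_add_right)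
    have "A *v x \<in> S'" "B *v x \<in> S'" if "x \<in> S'" for x
      using that v less.prems by (auto simp: S'_def inner_symmetric_matrix sym)
    moreover have "dim S' < dim S"
    proof -
      have "S' \<subseteq> S" "v \<in> S" "v \<notin> S'" using v by (auto simp: S'_def)
      then have "S' \<subset> S" by blast
      then show ?thesis
        by (metis dim_psubset less.prems(1) span_eq_iff subS')
    qed
    ultimately obtain T where T: "T \<subseteq> S'" "S' \<subseteq> span T" "pairwise orthogonal T"
      "\<forall>x\<in>T. norm x = 1 \<and> (\<exists>c. A *v x = c *\<^sub>R x) \<and> (\<exists>c. B *v x = c *\<^sub>R x)"
      using less.hyps[OF _ subS'] by blast
    have "x \<in> span (insert v T)" if "x \<in> S" for x
    proof -
      have "x - (v \<bullet> x) *\<^sub>R v \<in> S'"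
        using that v less.prems(1) by (auto simp: S'_def inner_diff_right norm_eq_1 subspace_diff subspace_scale)
      then show ?thesis
        using T(2) by (metis span_breakdown_eq subsetD)
    qed
    moreover have "pairwise orthogonal (insert v T)"
      using T by (auto simp: pairwise_insert orthogonal_def S'_def inner_commute)
    ultimately show ?thesis
      using T v by (intro exI[of _ "insert v T"]) (auto simp: S'_def)
  qed
qed

lemma matrix_mult_diag: "(M ** diag k) $ i $ j = M $ i $ j * k $ j"
  by (simp add: matrix_matrix_mult_def diag_def if_distrib [of "(*) _"] cong: if_cong)

lemma diag_mult_vec: "(diag k *v x) $ i = k $ i * x $ i"
  by (simp add: matrix_vector_mult_def diag_def if_distrib [of "\<lambda>x. x * _"] cong: if_cong)

lemma transpose_diag [simp]: "transpose (diag k) = diag k"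
  by (auto simp: transpose_def diag_def vec_eq_iff)

lemma diag_mult_diag: "diag k ** diag l = diag (\<chi> i. k $ i * l $ i)"
  by (simp add: vec_eq_iff matrix_mult_diag) (simp add: diag_def)

lemma diag_one: "diag (\<chi> i. 1) = mat 1"
  by (simp add: diag_def mat_def vec_eq_iff)

text \<open>Serves twice: with \<open>A = B\<close> it is the spectral theorem, with the values of
  two commuting weights it settles the commuting case.\<close>

theorem commuting_symmetric_diagonalization:
  fixes A B :: "real^'d^'d"
  assumes sym: "transpose A = A" "transpose B = B" and comm: "A ** B = B ** A"
  obtains U l m where "orthogonal_matrix U"
    "A = U ** diag l ** transpose U" "B = U ** diag m ** transpose U"
proof -
  obtain T where T: "UNIV \<subseteq> span T" "pairwise orthogonal T" "\<And>x. x \<in> T \<Longrightarrow> norm x = 1"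
    and eig: "\<And>x. x \<in> T \<Longrightarrow> \<exists>c. A *v x = c *\<^sub>R x" "\<And>x. x \<in> T \<Longrightarrow> \<exists>c. B *v x = c *\<^sub>R x"
    using commuting_symmetric_orthonormal_eigenbasis[OF assms subspace_UNIV] by blast
  have "0 \<notin> T" using T(3) by force
  then have indep: "independent T" using T(2) pairwise_orthogonal_independent by blast
  \<comment> \<open>An orthonormal spanning set has as many elements as the index type, so it can be
    enumerated as the columns of a square matrix.\<close>
  have "card T = CARD('d)"
    using basis_card_eq_dim[OF _ T(1) indep] by (simp add: dim_UNIV)
  then obtain f :: "'d \<Rightarrow> real^'d" where f: "bij_betw f UNIV T"
    using finite_same_card_bij[of "UNIV :: 'd set" T] indep independent_bound by auto
  then have fT: "f j \<in> T" for j by (auto simp: bij_betw_def)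
  obtain l0 where l0: "\<And>x. x \<in> T \<Longrightarrow> A *v x = l0 x *\<^sub>R x" using eig(1) by metis
  obtain m0 where m0: "\<And>x. x \<in> T \<Longrightarrow> B *v x = m0 x *\<^sub>R x" using eig(2) by metis
  define U :: "real^'d^'d" where "U = (\<chi> i j. f j $ i)"
  have col: "column j U = f j" for j by (simp add: U_def column_def vec_eq_iff)
  have U: "orthogonal_matrix U"
    unfolding orthogonal_matrix_orthonormal_columns col
    using f T fT by (fastforce simp: pairwise_def bij_betw_def inj_on_def)
  have diagz: "M = U ** diag (\<chi> j. c (f j)) ** transpose U"
    if "\<And>x. x \<in> T \<Longrightarrow> M *v x = c x *\<^sub>R x" for M :: "real^'d^'d" and c
  proof -
    have "(M ** U) $ i $ j = (M *v f j) $ i" for i j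
      by (simp add: matrix_matrix_mult_def matrix_vector_mult_def U_def)
    then have "M ** U = U ** diag (\<chi> j. c (f j))"
      by (simp add: vec_eq_iff matrix_mult_diag that fT) (simp add: U_def)
    then have "U ** diag (\<chi> j. c (f j)) ** transpose U = M ** (U ** transpose U)"
      by (simp add: matrix_mul_assoc)
    then show ?thesis using U by (simp add: orthogonal_matrix_def)
  qed
  show thesis using that[OF U diagz diagz] l0 m0 by blast
qed

section \<open>Real powers and geometric means\<close>

lemma symmetric_diagonalization:
  fixes A :: "real^'d^'d"
  assumes "transpose A = A"
  obtains U l where "orthogonal_matrix U" "A = U ** diag l ** transpose U"
  using commuting_symmetric_diagonalization[OF assms assms refl] by metis

lemma transpose_congruence:
  "transpose B = B \<Longrightarrow> transpose (S ** B ** transpose S) = S ** B ** transpose S"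
  for B :: "real^'d^'d"
  by (simp add: matrix_transpose_mul matrix_mul_assoc)

lemma inner_congruence:
  "x \<bullet> ((S ** B ** transpose S) *v x) = (transpose S *v x) \<bullet> (B *v (transpose S *v x))"
  for B :: "real^'d^'d"
  by (simp add: inner_matrix_vector[of _ S] flip: matrix_vector_mul_assoc)

lemma inner_diag: "x \<bullet> (diag l *v x) = (\<Sum>i\<in>UNIV. l $ i * (x $ i)\<^sup>2)"
  by (simp add: inner_vec_def diag_mult_vec power2_eq_square algebra_simps)

lemma inner_congruence_diag:
  "x \<bullet> ((S ** diag l ** transpose S) *v x) = (\<Sum>i\<in>UNIV. l $ i * ((transpose S *v x) $ i)\<^sup>2)"
  by (simp add: inner_congruence inner_diag)

section \<open>Positivity under congruence\<close>

lemma pos_semidef_symmetric: "pos_semidef A \<Longrightarrow> transpose A = A"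
  by (simp add: pos_semidef_def)

lemma pos_def_imp_pos_semidef: "pos_def A \<Longrightarrow> pos_semidef A"
  unfolding pos_def_def pos_semidef_def by (metis inner_zero_left less_imp_le order_refl)

lemma pos_semidef_congruence:
  "pos_semidef B \<Longrightarrow> pos_semidef (S ** B ** transpose S)"
  by (simp add: pos_semidef_def transpose_congruence inner_congruence)

lemma pos_semidef_diag: "(\<And>i. 0 \<le> l $ i) \<Longrightarrow> pos_semidef (diag l)"
  by (simp add: pos_semidef_def inner_diag sum_nonneg)

lemma invertible_mult_vec_eq_0:
  fixes S :: "real^'d^'d"
  assumes "invertible S" shows "S *v x = 0 \<longleftrightarrow> x = 0"
  by (metis assms inj_eq inj_matrix_vector_mult matrix_vector_mult_0_right)

lemma pos_def_congruence:
  fixes S :: "real^'d^'d"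
  assumes "invertible S" "pos_def B" shows "pos_def (S ** B ** transpose S)"
proof -
  have "transpose S *v x \<noteq> 0" if "x \<noteq> 0" for x
    using that assms(1) by (metis invertible_mult_vec_eq_0 transpose_invertible)
  then show ?thesis
    using assms(2) by (simp add: pos_def_def transpose_congruence inner_congruence)
qed

lemma pos_def_diag: "(\<And>i. 0 < l $ i) \<Longrightarrow> pos_def (diag l)"
  for l :: "real^'d"
  unfolding pos_def_def inner_diag
proof (intro conjI allI impI)
  fix v :: "real^'d" assume l: "\<And>i. 0 < l $ i" and "v \<noteq> 0"
  then obtain i where "v $ i \<noteq> 0" by (auto simp: vec_eq_iff)
  then have "0 < l $ i * (v $ i)\<^sup>2" using l by simp
  also have "\<dots> \<le> (\<Sum>i\<in>UNIV. l $ i * (v $ i)\<^sup>2)"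
    by (rule member_le_sum) (auto simp: l less_imp_le)
  finally show "0 < (\<Sum>i\<in>UNIV. l $ i * (v $ i)\<^sup>2)" .
qed simp

lemma orthogonal_matrix_invertible: "orthogonal_matrix U \<Longrightarrow> invertible U"
  by (auto simp: orthogonal_matrix_def invertible_def)

lemma pos_def_invertible: "pos_def A \<Longrightarrow> invertible A"
  unfolding pos_def_def
  by (metis inner_zero_right invertible_left_inverse less_irrefl matrix_left_invertible_ker)

text \<open>Evaluating the form at the i-th column of \<open>U\<close> recovers the i-th eigenvalue,
  so definiteness can be read off from the eigenvalues.\<close>

lemma orthogonal_quadratic_axis:
  assumes U: "orthogonal_matrix U"
  shows "(U *v axis i 1) \<bullet> ((U ** diag l ** transpose U) *v (U *v axis i 1)) = l $ i"
    and "U *v axis i 1 \<noteq> 0"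
proof -
  have UU: "transpose U ** U = mat 1" using U by (simp add: orthogonal_matrix_def)
  have "transpose U *v (U *v axis i 1) = axis i 1"
    by (simp add: matrix_vector_mul_assoc UU)
  then show "(U *v axis i 1) \<bullet> ((U ** diag l ** transpose U) *v (U *v axis i 1)) = l $ i"
    by (simp add: inner_congruence inner_axis' diag_mult_vec)
  show "U *v axis i 1 \<noteq> 0"
    using U by (simp add: orthogonal_matrix_invertible invertible_mult_vec_eq_0)
qed

lemma pos_semidef_orthogonal_diag_iff:
  "orthogonal_matrix U \<Longrightarrow> pos_semidef (U ** diag l ** transpose U) \<longleftrightarrow> (\<forall>i. 0 \<le> l $ i)"
  by (metis orthogonal_quadratic_axis(1) pos_semidef_congruence pos_semidef_def pos_semidef_diag)

lemma pos_def_orthogonal_diag_iff: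
  "orthogonal_matrix U \<Longrightarrow> pos_def (U ** diag l ** transpose U) \<longleftrightarrow> (\<forall>i. 0 < l $ i)"
  by (metis orthogonal_matrix_invertible orthogonal_quadratic_axis pos_def_congruence pos_def_def
      pos_def_diag)

lemma orthogonal_diag_mult:
  assumes "orthogonal_matrix U"
  shows "(U ** diag l ** transpose U) ** (U ** diag m ** transpose U)
    = U ** diag (\<chi> i. l $ i * m $ i) ** transpose U"
proof -
  have "transpose U ** U = mat 1" using assms by (simp add: orthogonal_matrix_def)
  then have "transpose U ** (U ** X) = X" for X :: "real^'a^'a"
    by (simp add: matrix_mul_assoc)
  then show ?thesis
    by (simp flip: matrix_mul_assoc diag_mult_diag)
qed

section \<open>Calculus of real powers\<close>

lemma pos_semidef_mat_powr:
  assumes "transpose A = A" shows "pos_semidef (mat_powr A t)"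
proof -
  obtain U l where "orthogonal_matrix U" "A = U ** diag l ** transpose U"
    using symmetric_diagonalization[OF assms] .
  then show ?thesis
    by (simp add: mat_powr_diagonalization pos_semidef_orthogonal_diag_iff)
qed

lemma pos_def_mat_powr:
  assumes "pos_def A" shows "pos_def (mat_powr A t)"
proof -
  obtain U l where "orthogonal_matrix U" "A = U ** diag l ** transpose U"
    using symmetric_diagonalization assms by (metis pos_def_def)
  then show ?thesis
    using assms by (simp add: mat_powr_diagonalization pos_def_orthogonal_diag_iff powr_gt_zero less_imp_neq[THEN not_sym])
qed

lemma mat_powr_add:
  assumes "pos_semidef A" shows "mat_powr A s ** mat_powr A t = mat_powr A (s + t)"
proof -
  obtain U l where "orthogonal_matrix U" "A = U ** diag l ** transpose U"
    using symmetric_diagonalization assms by (metis pos_semidef_def)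
  then show ?thesis
    by (simp add: mat_powr_diagonalization orthogonal_diag_mult powr_add)
qed

lemma mat_powr_one:
  assumes "pos_semidef A" shows "mat_powr A 1 = A"
proof -
  obtain U l where U: "orthogonal_matrix U" "A = U ** diag l ** transpose U"
    using symmetric_diagonalization assms by (metis pos_semidef_def)
  then have "\<forall>i. 0 \<le> l $ i" using assms by (simp add: pos_semidef_orthogonal_diag_iff)
  then show ?thesis using U by (simp add: mat_powr_diagonalization)
qed

text \<open>Since \<open>0 powr 0 = 0\<close>, the zeroth power of a singular positive semidefinite
  matrix is only the projection onto its range; hence the strict positivity.\<close>

lemma mat_powr_zero:
  assumes "pos_def A" shows "mat_powr A 0 = mat 1"
proof -
  obtain U l where U: "orthogonal_matrix U" "A = U ** diag l ** transpose U"
    using symmetric_diagonalization assms by (metis pos_def_def)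
  then have "\<forall>i. l $ i \<noteq> 0" using assms
    by (metis pos_def_orthogonal_diag_iff less_irrefl)
  then show ?thesis using U
    by (simp add: mat_powr_diagonalization diag_one orthogonal_matrix_def)
qed

lemma mat_powr_half_mult_self: "pos_semidef A \<Longrightarrow> mat_powr A (1/2) ** mat_powr A (1/2) = A"
  by (simp add: mat_powr_add mat_powr_one)

lemma transpose_mat_powr: "transpose A = A \<Longrightarrow> transpose (mat_powr A t) = mat_powr A t"
  using pos_semidef_mat_powr pos_semidef_symmetric by blast

lemma pos_semidef_square: "transpose A = A \<Longrightarrow> pos_semidef (A ** A)" for A :: "real^'d^'d"
  using pos_semidef_congruence[of "mat 1" A] by (simp add: pos_semidef_def)

lemma pos_semidef_sandwich: "transpose A = A \<Longrightarrow> pos_semidef B \<Longrightarrow> pos_semidef (A ** B ** A)"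
  by (metis pos_semidef_congruence)

lemma pos_def_sandwich: "pos_def A \<Longrightarrow> pos_def B \<Longrightarrow> pos_def (A ** B ** A)"
  by (metis pos_def_congruence pos_def_def pos_def_invertible)

lemma pos_def_mat_1: "pos_def (mat 1)"
  by (simp add: pos_def_def transpose_mat)

lemma pos_def_square: "pos_def A \<Longrightarrow> pos_def (A ** A)"
  using pos_def_sandwich[OF _ pos_def_mat_1] by simp

section \<open>Geometric means\<close>

lemma pos_semidef_geom_mean:
  assumes "pos_semidef A" "pos_semidef B" shows "pos_semidef (geom_mean t A B)"
  unfolding geom_mean_def using assms
  by (intro pos_semidef_sandwich transpose_mat_powr pos_semidef_mat_powr)
    (simp_all add: pos_semidef_symmetric pos_semidef_sandwich transpose_mat_powr)

lemma pos_def_geom_mean: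
  assumes "pos_def A" "pos_def B" shows "pos_def (geom_mean t A B)"
  unfolding geom_mean_def using assms
  by (intro pos_def_sandwich pos_def_mat_powr)

text \<open>Take \<open>S\<close> = A^(1/2) U, where U diagonalizes A^(-1/2) B A^(-1/2). In the
  coordinates \<open>transpose S *v v\<close> the matrix mean becomes the scalar means 1^(1-t) d^t.
  The identity is written as a diagonal matrix so that all three forms expand by
  \<open>inner_congruence_diag\<close>.\<close>

lemma geom_mean_congruence_diag:
  fixes A B :: "real^'d^'d"
  assumes A: "pos_def A" and B: "pos_def B"
  obtains S :: "real^'d^'d" and d :: "real^'d" where "\<And>i. 0 < d $ i" "invertible S" "A = S ** diag (\<chi> i. 1) ** transpose S"
    "B = S ** diag d ** transpose S"
    "geom_mean t A B = S ** diag (\<chi> i. d $ i powr t) ** transpose S"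
proof -
  let ?H = "mat_powr A (1/2)" and ?J = "mat_powr A (-1/2)"
  note psA = pos_def_imp_pos_semidef[OF A]
  have H: "transpose ?H = ?H" using psA by (simp add: transpose_mat_powr pos_semidef_symmetric)
  have HH: "?H ** ?H = A" by (rule mat_powr_half_mult_self[OF psA])
  have HJ: "?H ** ?J = mat 1" "?J ** ?H = mat 1"
    using mat_powr_add[OF psA, of "1/2" "-1/2"] mat_powr_add[OF psA, of "-1/2" "1/2"] mat_powr_zero[OF A]
    by simp_all
  have C: "pos_def (?J ** B ** ?J)"
    by (intro pos_def_sandwich pos_def_mat_powr A B)
  then obtain U d where U: "orthogonal_matrix U" and Cd: "?J ** B ** ?J = U ** diag d ** transpose U"
    using symmetric_diagonalization by (metis pos_def_def)
  have UU: "U ** transpose U = mat 1" using U by (simp add: orthogonal_matrix_def)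
  have d: "0 < d $ i" for i
    using C unfolding Cd by (simp add: U pos_def_orthogonal_diag_iff)
  have cong: "(?H ** U) ** M ** transpose (?H ** U) = ?H ** (U ** M ** transpose U) ** ?H" for M
    by (simp add: matrix_transpose_mul H matrix_mul_assoc)
  have "?H ** (?J ** B ** ?J) ** ?H = (?H ** ?J) ** B ** (?J ** ?H)"
    by (simp only: matrix_mul_assoc)
  then have "B = (?H ** U) ** diag d ** transpose (?H ** U)"
    unfolding cong Cd[symmetric] by (simp only: HJ matrix_mul_lid matrix_mul_rid)
  moreover have "A = (?H ** U) ** diag (\<chi> i. 1) ** transpose (?H ** U)"
    unfolding cong diag_one by (simp add: UU HH)
  moreover have "geom_mean t A B = (?H ** U) ** diag (\<chi> i. d $ i powr t) ** transpose (?H ** U)"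
    unfolding cong geom_mean_def Cd by (simp add: mat_powr_diagonalization U)
  moreover have "invertible (?H ** U)"
    using U A by (intro invertible_mult pos_def_invertible pos_def_mat_powr orthogonal_matrix_invertible)
  ultimately show thesis using that[of d "?H ** U"] d by blast
qed

text \<open>In a common eigenbasis this is an identity between nonnegative scalars. Semidefiniteness
  suffices because \<open>0 powr _ = 0\<close> makes both sides vanish when an eigenvalue is zero;
  weights may be singular on a null set.\<close>

lemma mat_powr_half_geom_mean_commuting:
  fixes A B :: "real^'d^'d"
  assumes A: "pos_semidef A" and B: "pos_semidef B" and comm: "A ** B = B ** A"
  shows "mat_powr (geom_mean t (A ** A) (B ** B)) (1/2) = mat_powr A (1 - t) ** mat_powr B t"
proof -
  obtain U l m where U: "orthogonal_matrix U"
    and Ad: "A = U ** diag l ** transpose U" and Bd: "B = U ** diag m ** transpose U"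
    using commuting_symmetric_diagonalization comm A B by (metis pos_semidef_symmetric)
  have l: "0 \<le> l $ i" and m: "0 \<le> m $ i" for i
    using A B by (simp_all add: Ad Bd pos_semidef_orthogonal_diag_iff U)
  have "((a * a) powr (1/2) * ((a * a) powr (-1/2) * (b * b) * (a * a) powr (-1/2)) powr t
      * (a * a) powr (1/2)) powr (1/2) = a powr (1 - t) * b powr t"
    if "0 \<le> a" "0 \<le> b" for a b :: real
  proof (cases "a = 0 \<or> b = 0")
    case False
    then have "0 < a" "0 < b" using that by auto
    then obtain x y where "a = exp x" "b = exp y" by (metis exp_ln)
    then show ?thesis
      by (simp add: powr_def flip: exp_add) (simp add: algebra_simps)
  qed auto
  then show ?thesis
    using l m unfolding geom_mean_def Ad Bd
    by (simp add: orthogonal_diag_mult mat_powr_diagonalization U)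
qed

section \<open>Interpolation by the K-functional\<close>

text \<open>The bound t < 1 gives convergence at 0 and t > 0 at infinity. The value is the classical
  pi / sin (pi t), but only its lying strictly between 0 and \<infinity> matters, since it is
  cancelled.\<close>

lemma powr_kernel_integral_finite:
  fixes t :: real
  assumes "0 < t" "t < 1"
  shows "(\<integral>\<^sup>+s. ennreal (s powr (-t) / (1 + s)) * indicator {0<..} s \<partial>lborel) < \<infinity>"
proof -
  have "(\<integral>\<^sup>+s. ennreal (s powr (-t) / (1 + s)) * indicator {0<..} s \<partial>lborel)
    \<le> (\<integral>\<^sup>+s. ennreal (s powr (-t)) * indicator {0..1} s
          + ennreal (s powr (-t-1)) * indicator {1..} s \<partial>lborel)"
  proof (rule nn_integral_mono)
    fix s :: real
    consider "s \<le> 0" | "0 < s" "s \<le> 1" | "1 < s" by linarith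
    then show "ennreal (s powr (-t) / (1 + s)) * indicator {0<..} s
      \<le> ennreal (s powr (-t)) * indicator {0..1} s + ennreal (s powr (-t-1)) * indicator {1..} s"
    proof cases
      case 2
      then have "s powr (-t) / (1 + s) \<le> s powr (-t)" by (simp add: divide_le_eq mult_le_cancel_left1)
      with 2 have "ennreal (s powr (-t) / (1 + s)) * indicator {0<..} s \<le> ennreal (s powr (-t)) * indicator {0..1} s"
        by (simp add: ennreal_leI)
      then show ?thesis by (rule order_trans) simp
    next
      case 3
      then have "s powr (-t) / (1 + s) \<le> s powr (-t) / s" by (intro divide_left_mono) auto
      also have "\<dots> = s powr (-t-1)" using 3 by (simp add: powr_diff)
      finally show ?thesis using 3 by (simp add: ennreal_leI)
    qed simp
  qed
  also have "\<dots> = ennreal (1 powr (-t+1) / (-t+1)) + ennreal (- (1 powr (-t-1+1)) / (-t-1+1))"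
    using assms
    by (subst nn_integral_add; measurable?)
      (simp only: nn_integral_has_integral_lebesgue'[OF _ has_integral_powr_from_0]
        nn_integral_has_integral_lebesgue'[OF _ has_integral_powr_to_inf] powr_ge_zero; simp)
  also have "\<dots> < \<infinity>" by simp
  finally show ?thesis .
qed

lemma powr_kernel_integral_pos:
  fixes t :: real
  shows "0 < (\<integral>\<^sup>+s. ennreal (s powr (-t) / (1 + s)) * indicator {0<..} s \<partial>lborel)"
proof -
  let ?f = "\<lambda>s. ennreal (s powr (-t) / (1 + s)) * indicator {0<..} s"
  have "integral\<^sup>N lborel ?f \<noteq> 0"
  proof
    assume "integral\<^sup>N lborel ?f = 0"
    then have "AE s in lborel. ?f s = 0" by (subst (asm) nn_integral_0_iff_AE) measurable
    then have "AE s in lborel. s \<notin> {0<..<1::real}"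
      by eventually_elim (auto simp: indicator_def)
    then have "emeasure lborel {0<..<1::real} = 0"
      by (subst (asm) AE_iff_measurable[of "{0<..<1}"]) auto
    then show False by simp
  qed
  then show ?thesis using zero_less_iff_neq_zero by blast
qed

text \<open>Substituting d s for s writes d^t, up to a constant independent of d, as an average of
  the functions d / (1 + s d), which are the K-functionals of the next lemma.\<close>

lemma powr_kernel_integral_scale:
  fixes t d :: real
  assumes d: "0 < d"
  shows "(\<integral>\<^sup>+s. ennreal (s powr (-t) * (d / (1 + s * d))) * indicator {0<..} s \<partial>lborel)
    = ennreal (d powr t) * (\<integral>\<^sup>+s. ennreal (s powr (-t) / (1 + s)) * indicator {0<..} s \<partial>lborel)"
proof -
  let ?f = "\<lambda>s. ennreal (s powr (-t) / (1 + s)) * indicator {0<..} s"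
  have "integral\<^sup>N lborel ?f = ennreal d * (\<integral>\<^sup>+s. ?f (0 + d * s) \<partial>lborel)"
    using d by (subst nn_integral_real_affine[where c = d and t = 0]) auto
  then have "ennreal (d powr t) * integral\<^sup>N lborel ?f
    = (\<integral>\<^sup>+s. ennreal (d powr t) * (ennreal d * ?f (0 + d * s)) \<partial>lborel)"
    by (simp add: nn_integral_cmult)
  also have "\<dots> = (\<integral>\<^sup>+s. ennreal (s powr (-t) * (d / (1 + s * d))) * indicator {0<..} s \<partial>lborel)"
  proof (rule nn_integral_cong)
    fix s :: real
    show "ennreal (d powr t) * (ennreal d * ?f (0 + d * s))
      = ennreal (s powr (-t) * (d / (1 + s * d))) * indicator {0<..} s"
    proof (cases "0 < s")
      case True
      then have "d powr t * (d * ((d * s) powr (-t) / (1 + d * s))) = s powr (-t) * (d / (1 + s * d))"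
      proof -
        have "d powr t * (d * s) powr (-t) = s powr (-t)"
          using d True by (simp add: powr_mult powr_minus)
        then have "d powr t * (d * s) powr (-t) * (d / (1 + d * s)) = s powr (-t) * (d / (1 + d * s))"
          by simp
        then show ?thesis by (simp add: mult_ac)
      qed
      with True d show ?thesis
        by (simp add: ennreal_mult[symmetric] zero_less_mult_iff)
    next
      case False
      then have "\<not> 0 < d * s" using d by (simp add: zero_less_mult_iff)
      with False show ?thesis by simp
    qed
  qed
  finally show ?thesis ..
qed

text \<open>Here \<open>d / (1 + s d) c\<^sup>2\<close> is \<open>1/s\<close> times the minimum over \<open>x\<close> of \<open>x\<^sup>2 + s d (c - x)\<^sup>2\<close>, the quadratic
  \<open>K\<close>-functional of a pair of diagonal forms. Its monotonicity in both forms is evident from the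
  minimum, and averaging over \<open>s\<close> transfers it to the powers \<open>d\<^sup>t\<close>.\<close>

lemma K_functional_mono:
  fixes S1 S2 :: "real^'d^'d" and d1 d2 :: "real^'d"
  assumes inv: "invertible S2" and d1: "\<And>i. 0 < d1 $ i" and d2: "\<And>i. 0 < d2 $ i"
    and pos: "0 < \<alpha>" "0 < \<beta>" "0 < s"
    and le0: "\<And>v. (\<Sum>i\<in>UNIV. ((transpose S1 *v v) $ i)\<^sup>2) \<le> \<alpha> * (\<Sum>i\<in>UNIV. ((transpose S2 *v v) $ i)\<^sup>2)"
    and le1: "\<And>v. (\<Sum>i\<in>UNIV. d1 $ i * ((transpose S1 *v v) $ i)\<^sup>2)
      \<le> \<beta> * (\<Sum>i\<in>UNIV. d2 $ i * ((transpose S2 *v v) $ i)\<^sup>2)"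
  shows "(\<Sum>i\<in>UNIV. d1 $ i / (1 + s * d1 $ i) * ((transpose S1 *v v) $ i)\<^sup>2)
    \<le> (\<Sum>i\<in>UNIV. \<alpha> * (\<beta> / \<alpha> * d2 $ i / (1 + s * (\<beta> / \<alpha> * d2 $ i))) * ((transpose S2 *v v) $ i)\<^sup>2)"
proof -
  define e where "e i = s * (\<beta> / \<alpha> * d2 $ i)" for i
  have e: "0 < e i" for i using pos d2 by (simp add: e_def)
  define c where "c i = (transpose S2 *v v) $ i" for i
  \<comment> \<open>The optimal splitting v = u + (v - u) for the second pair, found coordinatewise
    and pulled back through the invertible \<open>S2\<close>. Used as a competitor for the first
    pair, it yields the inequality; the ratio \<beta> / \<alpha> is absorbed into
    \<open>e\<close>.\<close>
  obtain u where u: "transpose S2 *v u = (\<chi> i. e i / (1 + e i) * c i)"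
    by (metis inv invertible_def matrix_vector_mul_assoc matrix_vector_mul_lid transpose_invertible)
  have u2: "(transpose S2 *v u) $ i = e i / (1 + e i) * c i" for i by (simp only: u vec_lambda_beta)
  have vu2: "(transpose S2 *v (v - u)) $ i = 1 / (1 + e i) * c i" for i
  proof -
    have "c i - e i / (1 + e i) * c i = 1 / (1 + e i) * c i"
      using e[of i] by (simp add: field_simps)
    then show ?thesis
      by (simp only: matrix_vector_mult_diff_distrib vector_minus_component u2 flip: c_def)
  qed
  have min_le: "s * (d / (1 + s * d) * z\<^sup>2) \<le> x\<^sup>2 + s * (d * (z - x)\<^sup>2)" if "0 < d" for d x z
  proof -
    have p: "0 < 1 + s * d" using that pos by (simp add: add_pos_pos)
    have "(1 + s * d) * (x\<^sup>2 + s * (d * (z - x)\<^sup>2)) - s * d * z\<^sup>2 = ((1 + s * d) * x - s * d * z)\<^sup>2"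
      by (simp add: power2_eq_square algebra_simps)
    then have "s * d * z\<^sup>2 \<le> (x\<^sup>2 + s * (d * (z - x)\<^sup>2)) * (1 + s * d)"
      by (smt (verit) mult.commute zero_le_power2)
    then show ?thesis using p by (simp add: divide_le_eq mult.assoc)
  qed
  have "s * (\<Sum>i\<in>UNIV. d1 $ i / (1 + s * d1 $ i) * ((transpose S1 *v v) $ i)\<^sup>2)
    \<le> (\<Sum>i\<in>UNIV. ((transpose S1 *v u) $ i)\<^sup>2) + s * (\<Sum>i\<in>UNIV. d1 $ i * ((transpose S1 *v (v - u)) $ i)\<^sup>2)"
    unfolding sum_distrib_left sum.distrib[symmetric] matrix_vector_mult_diff_distrib vector_minus_component
    by (rule sum_mono, rule min_le, rule d1)
  also have "\<dots> \<le> \<alpha> * (\<Sum>i\<in>UNIV. ((transpose S2 *v u) $ i)\<^sup>2)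
      + s * (\<beta> * (\<Sum>i\<in>UNIV. d2 $ i * ((transpose S2 *v (v - u)) $ i)\<^sup>2))"
    using pos by (intro add_mono mult_left_mono le0 le1) auto
  also have "\<dots> = s * (\<Sum>i\<in>UNIV. \<alpha> * (\<beta> / \<alpha> * d2 $ i / (1 + e i)) * (c i)\<^sup>2)"
    unfolding sum_distrib_left sum.distrib[symmetric] u2 vu2
  proof (rule sum.cong[OF refl])
    fix i
    have "s * \<beta> * d2 $ i = \<alpha> * e i" using pos by (simp add: e_def)
    moreover have "\<alpha> * (e i / (1 + e i) * c i)\<^sup>2 + \<alpha> * e i * (1 / (1 + e i) * c i)\<^sup>2
      = \<alpha> * e i / (1 + e i) * (c i)\<^sup>2"
    proof -
      have "(e i)\<^sup>2 + e i = e i * (1 + e i)" by (simp add: power2_eq_square algebra_simps)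
      then have "\<alpha> * ((e i)\<^sup>2 + e i) * (c i)\<^sup>2 / (1 + e i)\<^sup>2 = \<alpha> * e i / (1 + e i) * (c i)\<^sup>2"
        using e[of i] by (simp add: power2_eq_square)
      then show ?thesis
        by (simp add: power_mult_distrib power_divide add_divide_distrib[symmetric] algebra_simps)
    qed
    ultimately show "\<alpha> * (e i / (1 + e i) * c i)\<^sup>2 + s * (\<beta> * (d2 $ i * (1 / (1 + e i) * c i)\<^sup>2))
      = s * (\<alpha> * (\<beta> / \<alpha> * d2 $ i / (1 + e i)) * (c i)\<^sup>2)"
      using pos by (simp add: mult.assoc[symmetric])
  qed
  finally show ?thesis using pos by (simp add: e_def c_def)
qed

text \<open>Integrate the K-functional inequality against s^(-t) and cancel the common constant
  \<open>I\<close>. The factor arises from \<alpha> (\<beta> / \<alpha>)^t = \<alpha>^(1-t)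
  \<beta>^t.\<close>

lemma powr_form_mono:
  fixes S1 S2 :: "real^'d^'d" and d1 d2 :: "real^'d"
  assumes inv: "invertible S2" and d1: "\<And>i. 0 < d1 $ i" and d2: "\<And>i. 0 < d2 $ i"
    and pos: "0 < \<alpha>" "0 < \<beta>" and t: "0 < t" "t < 1"
    and le0: "\<And>v. (\<Sum>i\<in>UNIV. ((transpose S1 *v v) $ i)\<^sup>2) \<le> \<alpha> * (\<Sum>i\<in>UNIV. ((transpose S2 *v v) $ i)\<^sup>2)"
    and le1: "\<And>v. (\<Sum>i\<in>UNIV. d1 $ i * ((transpose S1 *v v) $ i)\<^sup>2)
      \<le> \<beta> * (\<Sum>i\<in>UNIV. d2 $ i * ((transpose S2 *v v) $ i)\<^sup>2)"
  shows "(\<Sum>i\<in>UNIV. d1 $ i powr t * ((transpose S1 *v v) $ i)\<^sup>2)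
    \<le> \<alpha> powr (1 - t) * \<beta> powr t * (\<Sum>i\<in>UNIV. d2 $ i powr t * ((transpose S2 *v v) $ i)\<^sup>2)"
proof -
  define I where "I = (\<integral>\<^sup>+s. ennreal (s powr (-t) / (1 + s)) * indicator {0<..} s \<partial>lborel)"
  have I: "I \<noteq> 0" "I \<noteq> \<infinity>"
    using powr_kernel_integral_finite[OF t] powr_kernel_integral_pos[of t] by (auto simp: I_def)
  \<comment> \<open>The factor \<open>k\<close> lets one computation serve both sides, with
    \<open>k = 1\<close> and \<open>k = \<alpha>\<close>.\<close>
  have int: "(\<integral>\<^sup>+s. ennreal (s powr (-t) * (\<Sum>i\<in>UNIV. k * (d i / (1 + s * d i)) * c i)) * indicator {0<..} s \<partial>lborel)
      = ennreal (\<Sum>i\<in>UNIV. k * d i powr t * c i) * I"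
    if "\<And>i. 0 < d i" "\<And>i. 0 \<le> c i" "0 \<le> k" for d c :: "'d \<Rightarrow> real" and k :: real
  proof -
    have "(\<integral>\<^sup>+s. ennreal (s powr (-t) * (\<Sum>i\<in>UNIV. k * (d i / (1 + s * d i)) * c i)) * indicator {0<..} s \<partial>lborel)
      = (\<integral>\<^sup>+s. (\<Sum>i\<in>UNIV. ennreal (k * c i) * (ennreal (s powr (-t) * (d i / (1 + s * d i))) * indicator {0<..} s)) \<partial>lborel)"
    proof (rule nn_integral_cong)
      fix s :: real
      show "ennreal (s powr (-t) * (\<Sum>i\<in>UNIV. k * (d i / (1 + s * d i)) * c i)) * indicator {0<..} s
        = (\<Sum>i\<in>UNIV. ennreal (k * c i) * (ennreal (s powr (-t) * (d i / (1 + s * d i))) * indicator {0<..} s))"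
      proof (cases "0 < s")
        case True
        then have "0 < 1 + s * d i" for i using that by (simp add: add_pos_pos)
        then have nonneg: "0 \<le> s powr (-t) * (d i / (1 + s * d i))" for i
          using that(1)[of i] by (intro mult_nonneg_nonneg divide_nonneg_pos) (auto intro: less_imp_le)
        have "s powr (-t) * (\<Sum>i\<in>UNIV. k * (d i / (1 + s * d i)) * c i)
          = (\<Sum>i\<in>UNIV. k * c i * (s powr (-t) * (d i / (1 + s * d i))))"
          by (simp add: sum_distrib_left mult_ac)
        moreover have "0 \<le> k * c i * (s powr (-t) * (d i / (1 + s * d i)))" for i
          using mult_nonneg_nonneg[OF mult_nonneg_nonneg[OF that(3,2)] nonneg] .
        ultimately have "ennreal (s powr (-t) * (\<Sum>i\<in>UNIV. k * (d i / (1 + s * d i)) * c i))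
          = (\<Sum>i\<in>UNIV. ennreal (k * c i * (s powr (-t) * (d i / (1 + s * d i)))))"
          by (simp only: sum_ennreal)
        also have "\<dots> = (\<Sum>i\<in>UNIV. ennreal (k * c i) * ennreal (s powr (-t) * (d i / (1 + s * d i))))"
          using that nonneg by (intro sum.cong[OF refl] ennreal_mult nonneg) (simp add: mult_nonneg_nonneg)
        finally show ?thesis using True by simp
      qed simp
    qed
    also have "\<dots> = (\<Sum>i\<in>UNIV. \<integral>\<^sup>+s. ennreal (k * c i) * (ennreal (s powr (-t) * (d i / (1 + s * d i))) * indicator {0<..} s) \<partial>lborel)"
      by (rule nn_integral_sum) measurable
    also have "\<dots> = (\<Sum>i\<in>UNIV. ennreal (k * c i) * (ennreal (d i powr t) * I))"
    proof (rule sum.cong[OF refl])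
      fix i
      show "(\<integral>\<^sup>+s. ennreal (k * c i) * (ennreal (s powr (-t) * (d i / (1 + s * d i))) * indicator {0<..} s) \<partial>lborel)
        = ennreal (k * c i) * (ennreal (d i powr t) * I)"
        unfolding I_def powr_kernel_integral_scale[OF that(1), symmetric]
        by (rule nn_integral_cmult) measurable
    qed
    also have "\<dots> = (\<Sum>i\<in>UNIV. ennreal (k * d i powr t * c i)) * I"
      unfolding sum_distrib_right
      by (intro sum.cong[OF refl]) (use that in \<open>simp add: ennreal_mult mult_ac\<close>)
    also have "(\<Sum>i\<in>UNIV. ennreal (k * d i powr t * c i)) = ennreal (\<Sum>i\<in>UNIV. k * d i powr t * c i)"
      using that by (simp add: sum_ennreal)
    finally show ?thesis .
  qed
  let ?c1 = "\<lambda>i. ((transpose S1 *v v) $ i)\<^sup>2" and ?c2 = "\<lambda>i. ((transpose S2 *v v) $ i)\<^sup>2"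
  let ?d2 = "\<lambda>i. \<beta> / \<alpha> * d2 $ i"
  have "ennreal (\<Sum>i\<in>UNIV. 1 * d1 $ i powr t * ?c1 i) * I
    = (\<integral>\<^sup>+s. ennreal (s powr (-t) * (\<Sum>i\<in>UNIV. 1 * (d1 $ i / (1 + s * d1 $ i)) * ?c1 i)) * indicator {0<..} s \<partial>lborel)"
    using d1 by (subst int) auto
  also have "\<dots> \<le> (\<integral>\<^sup>+s. ennreal (s powr (-t) * (\<Sum>i\<in>UNIV. \<alpha> * (?d2 i / (1 + s * ?d2 i)) * ?c2 i)) * indicator {0<..} s \<partial>lborel)"
  proof (rule nn_integral_mono)
    fix s :: real
    show "ennreal (s powr (-t) * (\<Sum>i\<in>UNIV. 1 * (d1 $ i / (1 + s * d1 $ i)) * ?c1 i)) * indicator {0<..} s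
      \<le> ennreal (s powr (-t) * (\<Sum>i\<in>UNIV. \<alpha> * (?d2 i / (1 + s * ?d2 i)) * ?c2 i)) * indicator {0<..} s"
    proof (cases "0 < s")
      case True
      from K_functional_mono[OF inv d1 d2 pos this le0 le1, of v] True show ?thesis
        by (simp add: ennreal_leI mult_left_mono)
    qed simp
  qed
  also have "\<dots> = ennreal (\<Sum>i\<in>UNIV. \<alpha> * ?d2 i powr t * ?c2 i) * I"
    using d2 pos by (subst int) auto
  finally have "ennreal (\<Sum>i\<in>UNIV. 1 * d1 $ i powr t * ?c1 i) \<le> ennreal (\<Sum>i\<in>UNIV. \<alpha> * ?d2 i powr t * ?c2 i)"
    using I unfolding mult.commute[of _ I] by (subst (asm) ennreal_mult_le_mult_iff) auto
  then have "(\<Sum>i\<in>UNIV. 1 * d1 $ i powr t * ?c1 i) \<le> (\<Sum>i\<in>UNIV. \<alpha> * ?d2 i powr t * ?c2 i)"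
    using pos by (subst (asm) ennreal_le_iff) (auto intro!: sum_nonneg)
  moreover have "\<alpha> * ?d2 i powr t = \<alpha> powr (1 - t) * \<beta> powr t * d2 $ i powr t" for i
    using pos d2[of i] by (simp add: powr_mult powr_divide powr_diff)
  ultimately show ?thesis by (simp only: sum_distrib_left mult.assoc mult_1)
qed

text \<open>The two pairs are diagonalized by different congruences, so \<open>d1\<close> and
  \<open>d2\<close> cannot be compared entry by entry. The K-functional depends on the forms alone
  and bridges the two coordinate systems.\<close>

theorem geom_mean_mono:
  fixes A1 A2 B1 B2 :: "real^'d^'d"
  assumes pd: "pos_def A1" "pos_def A2" "pos_def B1" "pos_def B2"
    and pos: "0 < \<alpha>" "0 < \<beta>" and t: "0 < t" "t < 1"
    and leA: "\<And>v. v \<bullet> (A1 *v v) \<le> \<alpha> * (v \<bullet> (A2 *v v))"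
    and leB: "\<And>v. v \<bullet> (B1 *v v) \<le> \<beta> * (v \<bullet> (B2 *v v))"
  shows "v \<bullet> (geom_mean t A1 B1 *v v) \<le> \<alpha> powr (1 - t) * \<beta> powr t * (v \<bullet> (geom_mean t A2 B2 *v v))"
proof -
  obtain S1 :: "real^'d^'d" and d1 where 1: "\<And>i. 0 < d1 $ i" "invertible S1" "A1 = S1 ** diag (\<chi> i. 1) ** transpose S1"
    "B1 = S1 ** diag d1 ** transpose S1"
    "geom_mean t A1 B1 = S1 ** diag (\<chi> i. d1 $ i powr t) ** transpose S1"
    by (rule geom_mean_congruence_diag[OF pd(1,3), of t]) (rule that)
  obtain S2 :: "real^'d^'d" and d2 where 2: "\<And>i. 0 < d2 $ i" "invertible S2"
    "A2 = S2 ** diag (\<chi> i. 1) ** transpose S2" "B2 = S2 ** diag d2 ** transpose S2"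
    "geom_mean t A2 B2 = S2 ** diag (\<chi> i. d2 $ i powr t) ** transpose S2"
    by (rule geom_mean_congruence_diag[OF pd(2,4), of t]) (rule that)
  show ?thesis
    using powr_form_mono[OF 2(2) 1(1) 2(1) pos t, of S1 v] leA leB
    unfolding 1(5) 2(5) unfolding 1(3,4) 2(3,4) inner_congruence_diag by simp
qed

section \<open>Operator norms\<close>

lemma norm_le_op_norm: "norm (A *v x) \<le> op_norm A * norm x"
  unfolding op_norm_def by (rule onorm) simp

lemma op_norm_nonneg: "0 \<le> op_norm A"
  unfolding op_norm_def by (rule onorm_pos_le) simp

lemma op_norm_le: "0 \<le> b \<Longrightarrow> (\<And>x. norm (A *v x) \<le> b * norm x) \<Longrightarrow> op_norm A \<le> b"
  unfolding op_norm_def by (rule onorm_bound)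

lemma op_norm_mult_le: "op_norm (A ** B) \<le> op_norm A * op_norm B"
proof (rule op_norm_le)
  fix x
  have "norm (A *v (B *v x)) \<le> op_norm A * norm (B *v x)" by (rule norm_le_op_norm)
  also have "\<dots> \<le> op_norm A * (op_norm B * norm x)"
    by (intro mult_left_mono norm_le_op_norm op_norm_nonneg)
  finally show "norm ((A ** B) *v x) \<le> op_norm A * op_norm B * norm x"
    by (simp add: matrix_vector_mul_assoc mult.assoc)
qed (simp add: op_norm_nonneg)

lemma op_norm_transpose: "op_norm (transpose A) = op_norm A"
proof -
  have le: "op_norm (transpose A) \<le> op_norm A" for A :: "real^'a^'a"
  proof (rule op_norm_le[OF op_norm_nonneg])
    fix x
    let ?y = "transpose A *v x"
    have "norm ?y * norm ?y = x \<bullet> (A *v ?y)"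
      by (simp only: inner_matrix_vector power2_norm_eq_inner flip: power2_eq_square)
    also have "\<dots> \<le> norm x * (op_norm A * norm ?y)"
      by (intro order_trans[OF norm_cauchy_schwarz] mult_left_mono norm_le_op_norm norm_ge_zero)
    finally have "norm ?y * norm ?y \<le> op_norm A * norm x * norm ?y" by (simp only: mult_ac)
    then show "norm ?y \<le> op_norm A * norm x"
      by (cases "norm ?y = 0") (auto simp: op_norm_nonneg)
  qed
  show ?thesis using le[of A] le[of "transpose A"] by simp
qed

text \<open>For a product W(x) E the columns are W(x) applied to fixed vectors, so this bound can be
  averaged over x one column at a time.\<close>

lemma op_norm_le_sum_columns: "op_norm A \<le> (\<Sum>j\<in>UNIV. norm (column j A))"
proof (rule op_norm_le)
  fix x
  have "norm (A *v x) = norm (\<Sum>j\<in>UNIV. x $ j *\<^sub>R column j A)"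
    by (simp add: matrix_mult_sum scalar_mult_eq_scaleR)
  also have "\<dots> \<le> (\<Sum>j\<in>UNIV. norm (x $ j *\<^sub>R column j A))" by (rule norm_sum)
  also have "\<dots> \<le> (\<Sum>j\<in>UNIV. norm x * norm (column j A))"
    by (intro sum_mono) (simp add: component_le_norm_cart mult_right_mono)
  finally show "norm (A *v x) \<le> (\<Sum>j\<in>UNIV. norm (column j A)) * norm x"
    by (simp add: sum_distrib_left mult.commute)
qed (simp add: sum_nonneg)

lemma matrix_inv_cancel:
  fixes A :: "real^'d^'d"
  assumes "invertible A"
  shows "A ** matrix_inv A = mat 1" "matrix_inv A ** A = mat 1"
    "A *v (matrix_inv A *v x) = x" "matrix_inv A *v (A *v x) = x"
    "X ** matrix_inv A ** A = X" "X ** A ** matrix_inv A = X"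
proof -
  show 1: "A ** matrix_inv A = mat 1" "matrix_inv A ** A = mat 1"
    using assms unfolding invertible_def matrix_inv_def by (metis (mono_tags, lifting) someI_ex)+
  show "A *v (matrix_inv A *v x) = x" "matrix_inv A *v (A *v x) = x"
    by (simp_all add: matrix_vector_mul_assoc 1)
  show "X ** matrix_inv A ** A = X" "X ** A ** matrix_inv A = X"
    by (simp_all add: 1 flip: matrix_mul_assoc)
qed

lemma transpose_matrix_inv:
  fixes A :: "real^'d^'d"
  assumes "invertible A" "transpose A = A"
  shows "transpose (matrix_inv A) = matrix_inv A"
proof -
  have "transpose (matrix_inv A) ** A = mat 1"
    using matrix_inv_cancel(1)[OF assms(1)] assms(2) by (metis matrix_transpose_mul transpose_mat)
  then show ?thesis
    by (metis assms(1) matrix_inv_cancel(6) matrix_mul_lid)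
qed

text \<open>Together with the next lemma this characterizes
  \<open>op_norm (X ** matrix_inv Y)\<close> as the best constant in a comparison of norms, free of
  inverses.\<close>

lemma norm_le_op_norm_mult_inv:
  fixes X Y :: "real^'d^'d"
  assumes "invertible Y"
  shows "norm (X *v v) \<le> op_norm (X ** matrix_inv Y) * norm (Y *v v)"
  using norm_le_op_norm[of "X ** matrix_inv Y" "Y *v v"]
  by (simp only: matrix_vector_mul_assoc[symmetric] matrix_inv_cancel(4)[OF assms])

lemma op_norm_mult_inv_le:
  fixes X Y :: "real^'d^'d"
  assumes "invertible Y" "0 \<le> k" "\<And>v. norm (X *v v) \<le> k * norm (Y *v v)"
  shows "op_norm (X ** matrix_inv Y) \<le> k"
  using assms(3)[of "matrix_inv Y *v _"]
  by (intro op_norm_le assms) (simp only: matrix_vector_mul_assoc[symmetric] matrix_inv_cancel(3)[OF assms(1)])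

lemma op_norm_pos:
  assumes "invertible A" shows "0 < op_norm A"
proof -
  have "A *v axis undefined 1 \<noteq> 0"
    by (simp add: invertible_mult_vec_eq_0[OF assms])
  then have "0 < norm (A *v axis undefined 1)" by simp
  also have "\<dots> \<le> op_norm A * 1" using norm_le_op_norm[of A "axis undefined 1"] by simp
  finally show ?thesis by simp
qed

text \<open>Transposition reconciles the A_1 condition, which has the inverse on the left, with the
  other two conditions, which have it on the right.\<close>

lemma op_norm_inv_mult_flip:
  fixes X Y :: "real^'d^'d"
  assumes "transpose X = X" "transpose Y = Y" "invertible Y"
  shows "op_norm (matrix_inv Y ** X) = op_norm (X ** matrix_inv Y)"
  using op_norm_transpose[of "X ** matrix_inv Y"] assms
  by (simp add: matrix_transpose_mul transpose_matrix_inv)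

lemma inner_square: "transpose A = A \<Longrightarrow> v \<bullet> ((A ** A) *v v) = (norm (A *v v))\<^sup>2"
  for A :: "real^'d^'d"
  by (metis inner_symmetric_matrix matrix_vector_mul_assoc power2_norm_eq_inner)

text \<open>Squaring turns the norm comparisons into form comparisons with constants
  \<open>?a\<^sup>2\<close> and \<open>?b\<^sup>2\<close>; \<open>geom_mean_mono\<close>
  interpolates these, and the square root of the resulting constant is the claimed one.\<close>

theorem op_norm_geom_mean_interpolation:
  fixes X0 X1 Y0 Y1 :: "real^'d^'d"
  assumes pd: "pos_def X0" "pos_def X1" "pos_def Y0" "pos_def Y1" and t: "0 < t" "t < 1"
  shows "op_norm (mat_powr (geom_mean t (X0 ** X0) (X1 ** X1)) (1/2) **
      matrix_inv (mat_powr (geom_mean t (Y0 ** Y0) (Y1 ** Y1)) (1/2)))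
    \<le> op_norm (X0 ** matrix_inv Y0) powr (1 - t) * op_norm (X1 ** matrix_inv Y1) powr t"
proof (rule op_norm_mult_inv_le)
  let ?GX = "geom_mean t (X0 ** X0) (X1 ** X1)" and ?GY = "geom_mean t (Y0 ** Y0) (Y1 ** Y1)"
  let ?a = "op_norm (X0 ** matrix_inv Y0)" and ?b = "op_norm (X1 ** matrix_inv Y1)"
  have GX: "pos_def ?GX" and GY: "pos_def ?GY"
    using pd by (auto intro!: pos_def_geom_mean pos_def_square)
  show "invertible (mat_powr ?GY (1/2))"
    using GY by (intro pos_def_invertible pos_def_mat_powr)
  have inv: "invertible X0" "invertible X1" "invertible Y0" "invertible Y1"
    using pd by (auto intro: pos_def_invertible)
  have sym: "transpose X0 = X0" "transpose X1 = X1" "transpose Y0 = Y0" "transpose Y1 = Y1"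
    using pd by (auto simp: pos_def_def)
  have inv': "invertible (matrix_inv Y)" if "invertible Y" for Y :: "real^'d^'d"
    using matrix_inv_cancel(1,2)[OF that] unfolding invertible_def by blast
  have ab: "0 < ?a" "0 < ?b"
    by (intro op_norm_pos invertible_mult inv inv')+
  have le: "v \<bullet> ((X ** X) *v v) \<le> (op_norm (X ** matrix_inv Y))\<^sup>2 * (v \<bullet> ((Y ** Y) *v v))"
    if "transpose X = X" "transpose Y = Y" "invertible Y" for X Y :: "real^'d^'d" and v
    using norm_le_op_norm_mult_inv[OF that(3), of X v]
    by (simp add: inner_square that power_mono flip: power_mult_distrib)
  fix v
  have norm_half: "(norm (mat_powr G (1/2) *v v))\<^sup>2 = v \<bullet> (G *v v)" if "pos_def G" for G :: "real^'d^'d"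
    using that pos_def_imp_pos_semidef[OF that] mat_powr_half_mult_self[of G]
      inner_square[OF transpose_mat_powr[of G "1/2"], of v]
    by (simp add: pos_semidef_symmetric)
  have "v \<bullet> (?GX *v v) \<le> (?a\<^sup>2) powr (1 - t) * (?b\<^sup>2) powr t * (v \<bullet> (?GY *v v))"
    using pd sym inv ab t
    by (intro geom_mean_mono le pos_def_square) auto
  also have "(?a\<^sup>2) powr (1 - t) * (?b\<^sup>2) powr t = (?a powr (1 - t) * ?b powr t)\<^sup>2"
    using ab by (simp add: power2_eq_square powr_mult mult_ac)
  finally have "(norm (mat_powr ?GX (1/2) *v v))\<^sup>2
      \<le> (?a powr (1 - t) * ?b powr t * norm (mat_powr ?GY (1/2) *v v))\<^sup>2"
    by (simp only: norm_half[OF GX] power_mult_distrib norm_half[OF GY])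
  then show "norm (mat_powr ?GX (1/2) *v v) \<le> ?a powr (1 - t) * ?b powr t * norm (mat_powr ?GY (1/2) *v v)"
    by (rule power2_le_imp_le) simp
qed simp

section \<open>Auerbach bases\<close>

lemma continuous_on_det:
  fixes f :: "'a::topological_space \<Rightarrow> real^'d^'d"
  assumes "continuous_on S f" shows "continuous_on S (\<lambda>x. det (f x))"
  unfolding det_def
  by (intro continuous_on_sum continuous_on_mult continuous_on_const continuous_on_prod
      continuous_on_component assms)

text \<open>The columns of \<open>E\<close> form an Auerbach basis of the norm \<open>N\<close>: they maximize the determinant
  among vectors of norm at most one, so by Cramer's rule the coordinate functionals have norm
  at most one.\<close>

theorem Auerbach_basis:
  fixes N :: "real^'d \<Rightarrow> real"
  assumes tri: "\<And>x y. N (x + y) \<le> N x + N y" and hom: "\<And>c x. N (c *\<^sub>R x) = \<bar>c\<bar> * N x"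
    and pos: "\<And>x. x \<noteq> 0 \<Longrightarrow> 0 < N x"
  obtains E :: "real^'d^'d" where "invertible E" "\<And>j. N (column j E) \<le> 1"
    "\<And>v i. \<bar>v $ i\<bar> \<le> N (E *v v)"
proof -
  have N0: "N 0 = 0" using hom[of 0 0] by simp
  have Nge0: "0 \<le> N x" for x using pos[of x] N0 by (cases "x = 0") auto
  have Nsum: "N (sum f A) \<le> (\<Sum>i\<in>A. N (f i))" if "finite A" for f :: "'d \<Rightarrow> real^'d" and A
    using that by (induction A) (auto simp: N0 intro: order_trans[OF tri])
  define C where "C = (\<Sum>i\<in>UNIV. N (axis i 1 :: real^'d))"
  have C: "N x \<le> C * norm x" for x
  proof -
    have "N x = N (\<Sum>i\<in>UNIV. x $ i *\<^sub>R axis i 1)"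
      using basis_expansion[of x] by (simp add: scalar_mult_eq_scaleR)
    also have "\<dots> \<le> (\<Sum>i\<in>UNIV. \<bar>x $ i\<bar> * N (axis i 1))"
      using Nsum[of UNIV "\<lambda>i. x $ i *\<^sub>R axis i 1"] by (simp add: hom)
    also have "\<dots> \<le> (\<Sum>i\<in>UNIV. norm x * N (axis i 1))"
      by (intro sum_mono mult_right_mono component_le_norm_cart Nge0)
    finally show ?thesis by (simp add: C_def sum_distrib_left mult.commute)
  qed
  have axis_pos: "0 < N (axis i 1 :: real^'d)" for i by (intro pos) simp
  then have Cpos: "0 < C" unfolding C_def by (intro sum_pos) auto
  have cont: "continuous_on UNIV N"
  proof (rule continuous_onI)
    fix x :: "real^'d" and e :: real assume "0 < e"
    moreover have "dist (N y) (N x) < e" if "dist y x < e / C" for y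
    proof -
      have "N y \<le> N (y - x) + N x" "N x \<le> N (- 1 *\<^sub>R (y - x)) + N y"
        using tri[of "y - x" x] tri[of "- 1 *\<^sub>R (y - x)" y] by simp_all
      then have "\<bar>N y - N x\<bar> \<le> N (y - x)" using hom[of "-1" "y - x"] by simp
      also have "\<dots> \<le> C * norm (y - x)" by (rule C)
      also have "\<dots> < e" using that Cpos by (simp add: dist_norm field_simps)
      finally show ?thesis by (simp add: dist_real_def)
    qed
    ultimately show "\<exists>d>0. \<forall>y\<in>UNIV. dist y x < d \<longrightarrow> dist (N y) (N x) \<le> e"
      using Cpos by (intro exI[of _ "e / C"]) (auto intro: less_imp_le)
  qed
  \<comment> \<open>The lower equivalence constant, the minimum of \<open>N\<close> on the unit
    sphere; it bounds the entries of the matrices in \<open>K\<close>.\<close>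
  obtain b where b: "0 < b" "\<And>x. b * norm x \<le> N x"
  proof -
    obtain x0 where x0: "x0 \<in> sphere 0 1" "\<And>y. y \<in> sphere 0 1 \<Longrightarrow> N x0 \<le> N y"
    proof -
      have "compact (sphere (0::real^'d) 1)" "sphere (0::real^'d) 1 \<noteq> {}" by simp_all
      from continuous_attains_inf[OF this continuous_on_subset[OF cont subset_UNIV]]
      show thesis using that by blast
    qed
    have "N x0 * norm x \<le> N x" for x
    proof (cases "x = 0")
      case False
      then have "N x0 \<le> N ((1 / norm x) *\<^sub>R x)" by (intro x0) simp
      then show ?thesis using False by (simp add: hom field_simps)
    qed (simp add: N0)
    moreover have "0 < N x0" using x0 by (intro pos) auto
    ultimately show thesis using that by blast
  qed
  define K where "K = {E :: real^'d^'d. \<forall>j. N (column j E) \<le> 1}"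
  have "compact K"
  proof (rule compact_eq_bounded_closed[THEN iffD2], intro conjI)
    have "closed {E :: real^'d^'d. N (column j E) \<le> 1}" for j
    proof (rule closed_Collect_le)
      show "continuous_on UNIV (\<lambda>E :: real^'d^'d. N (column j E))"
        unfolding column_def
        by (rule continuous_on_compose2[OF cont]) (auto intro!: continuous_intros)
    qed simp
    then show "closed K" unfolding K_def by (rule closed_Collect_all)
    have "norm E \<le> (\<Sum>i\<in>(UNIV :: 'd set). \<Sum>j\<in>(UNIV :: 'd set). 1 / b)" if "E \<in> K" for E :: "real^'d^'d"
    proof -
      have entry: "norm (E $ i $ j) \<le> 1 / b" for i j
      proof -
        have "b * norm (E $ i $ j) \<le> b * norm (column j E)"
          using component_le_norm_cart[of "column j E" i] b(1) by (simp add: column_def)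
        also have "\<dots> \<le> N (column j E)" by (rule b(2))
        also have "\<dots> \<le> 1" using that by (simp add: K_def)
        finally show ?thesis using b(1) by (simp add: field_simps)
      qed
      have "norm E \<le> (\<Sum>i\<in>UNIV. norm (E $ i))"
        by (simp add: norm_vec_def L2_set_le_sum)
      also have "\<dots> \<le> (\<Sum>i\<in>UNIV. \<Sum>j\<in>UNIV. norm (E $ i $ j))"
        unfolding norm_vec_def[of "E $ _"] by (intro sum_mono L2_set_le_sum) simp
      also have "\<dots> \<le> (\<Sum>i\<in>(UNIV :: 'd set). \<Sum>j\<in>(UNIV :: 'd set). 1 / b)"
        by (intro sum_mono entry)
      finally show ?thesis .
    qed
    then show "bounded K" unfolding bounded_iff by (intro exI ballI)
  qed
  \<comment> \<open>The normalized standard basis, a member of \<open>K\<close> with nonzero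
    determinant; it guarantees that the maximizer is invertible.\<close>
  define E0 :: "real^'d^'d" where "E0 = diag (\<chi> i. 1 / N (axis i 1))"
  have "column j E0 = (1 / N (axis j 1)) *\<^sub>R axis j 1" for j
    by (simp add: E0_def column_def diag_def axis_def vec_eq_iff)
  then have E0: "E0 \<in> K" using axis_pos by (simp add: K_def hom order_less_imp_le less_imp_neq[THEN not_sym])
  have detE0: "det E0 \<noteq> 0"
  proof -
    have "det E0 = (\<Prod>i\<in>UNIV. E0 $ i $ i)"
      by (rule det_diagonal) (simp add: E0_def diag_def)
    then show ?thesis using axis_pos by (simp add: E0_def diag_def less_imp_neq[THEN not_sym])
  qed
  obtain E where E: "E \<in> K" "\<And>F. F \<in> K \<Longrightarrow> \<bar>det F\<bar> \<le> \<bar>det E\<bar>"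
  proof -
    have "continuous_on K (\<lambda>E. \<bar>det E\<bar>)"
      by (intro continuous_on_rabs continuous_on_det continuous_on_id)
    then show thesis
      using that continuous_attains_sup[OF \<open>compact K\<close>] E0 by blast
  qed
  have detE: "0 < \<bar>det E\<bar>" using E(2)[OF E0] detE0 by simp
  then have inv: "invertible E" by (simp add: invertible_det_nz)
  have "\<bar>v $ k\<bar> \<le> N (E *v v)" for v k
  proof (cases "E *v v = 0")
    case True
    then show ?thesis using inv by (simp add: invertible_mult_vec_eq_0 N0)
  next
    case False
    define r where "r = N (E *v v)"
    have r: "0 < r" using pos False by (simp add: r_def)
    let ?x = "(1 / r) *\<^sub>R v"
    \<comment> \<open>Replacing the k-th column of \<open>E\<close> by the normalized
      \<open>E *v v\<close> stays in \<open>K\<close> and, by Cramer's rule, multiplies the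
      determinant by the k-th coordinate of \<open>?x\<close>. Maximality bounds that coordinate by
      one.\<close>
    let ?F = "(\<chi> i j. if j = k then (E *v ?x) $ i else E $ i $ j) :: real^'d^'d"
    have "column j ?F = (if j = k then (1 / r) *\<^sub>R (E *v v) else column j E)" for j
      by (simp add: column_def vec_eq_iff matrix_vector_mult_scaleR)
    then have "?F \<in> K" using E(1) r by (simp add: K_def hom flip: r_def)
    then have "\<bar>?x $ k * det E\<bar> \<le> \<bar>det E\<bar>" using E(2)[of ?F] by (simp only: cramer_lemma)
    then have "\<bar>?x $ k\<bar> * \<bar>det E\<bar> \<le> 1 * \<bar>det E\<bar>" by (simp only: abs_mult mult_1)
    then have "\<bar>?x $ k\<bar> \<le> 1" using detE by (simp only: mult_le_cancel_right_pos)
    then have "\<bar>v $ k\<bar> \<le> r" using r by (simp add: abs_mult field_simps)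
    then show ?thesis by (simp only: r_def)
  qed
  then show thesis using that[OF inv] E(1) by (simp add: K_def)
qed

section \<open>Measurability of powers of matrix weights\<close>

text \<open>Needed because eigenbases converge only along subsequences, while their limits all yield
  the same matrix power.\<close>

lemma LIMSEQ_if_subsubsequences:
  fixes X :: "nat \<Rightarrow> 'a::metric_space"
  assumes "\<And>r :: nat \<Rightarrow> nat. strict_mono r \<Longrightarrow> \<exists>s. strict_mono s \<and> (X \<circ> r \<circ> s) \<longlonglongrightarrow> L"
  shows "X \<longlonglongrightarrow> L"
proof (rule ccontr)
  assume "\<not> X \<longlonglongrightarrow> L"
  then obtain e where e: "0 < e" "\<not> eventually (\<lambda>n. dist (X n) L < e) sequentially"
    by (auto simp: tendsto_iff)
  then have "infinite {n. e \<le> dist (X n) L}"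
    by (auto simp: eventually_sequentially infinite_nat_iff_unbounded_le not_less)
  then obtain r :: "nat \<Rightarrow> nat" where r: "strict_mono r" "\<And>n. e \<le> dist (X (r n)) L"
    using infinite_enumerate by blast
  from assms[OF r(1)] obtain s where "(X \<circ> r \<circ> s) \<longlonglongrightarrow> L" by blast
  then have "eventually (\<lambda>n. dist ((X \<circ> r \<circ> s) n) L < e) sequentially"
    using e(1) by (auto simp: tendsto_iff)
  then have "\<exists>n. dist ((X \<circ> r \<circ> s) n) L < e" by (rule eventually_happens'[OF sequentially_bot])
  then show False using r(2) by (auto simp: not_less[symmetric])
qed

lemma tendsto_matrix_mult:
  fixes f :: "'b \<Rightarrow> real^'n^'m" and g :: "'b \<Rightarrow> real^'k^'n"
  assumes "(f \<longlongrightarrow> A) F" "(g \<longlongrightarrow> B) F"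
  shows "((\<lambda>x. f x ** g x) \<longlongrightarrow> A ** B) F"
  unfolding matrix_matrix_mult_def
  by (intro tendsto_vec_lambda tendsto_sum tendsto_mult tendsto_vec_nth assms)

lemma tendsto_transpose:
  fixes f :: "'b \<Rightarrow> real^'n^'m"
  assumes "(f \<longlongrightarrow> A) F" shows "((\<lambda>x. transpose (f x)) \<longlongrightarrow> transpose A) F"
  unfolding transpose_def by (intro tendsto_vec_lambda tendsto_vec_nth assms)

lemma tendsto_diag:
  assumes "\<And>i. ((\<lambda>x. f x $ i) \<longlongrightarrow> l $ i) F"
  shows "((\<lambda>x. diag (f x)) \<longlongrightarrow> diag l) F"
  unfolding diag_def
proof (intro tendsto_vec_lambda)
  fix i j show "((\<lambda>x. if i = j then f x $ i else 0) \<longlongrightarrow> (if i = j then l $ i else 0)) F"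
    using assms by (cases "i = j") auto
qed

lemma compact_orthogonal_matrices: "compact {U :: real^'d^'d. orthogonal_matrix U}"
proof (rule compact_eq_bounded_closed[THEN iffD2], intro conjI)
  have "norm U \<le> (\<Sum>i\<in>(UNIV :: 'd set). 1)" if "orthogonal_matrix U" for U :: "real^'d^'d"
  proof -
    have "norm (U $ i) = 1" for i
      using that by (auto simp: orthogonal_matrix_orthonormal_rows row_def)
    then show ?thesis
      using L2_set_le_sum[of UNIV "\<lambda>i. norm (U $ i)"] by (simp add: norm_vec_def[of U])
  qed
  then show "bounded {U :: real^'d^'d. orthogonal_matrix U}"
    unfolding bounded_iff by blast
  have "transpose U ** U = mat 1"
    if "\<And>n. transpose (V n) ** V n = mat 1" "V \<longlonglongrightarrow> U" for V and U :: "real^'d^'d"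
  proof (rule LIMSEQ_unique)
    show "(\<lambda>n. transpose (V n) ** V n) \<longlonglongrightarrow> transpose U ** U"
      by (intro tendsto_matrix_mult tendsto_transpose that(2))
    show "(\<lambda>n. transpose (V n) ** V n) \<longlonglongrightarrow> mat 1"
      by (simp add: that(1))
  qed
  then show "closed {U :: real^'d^'d. orthogonal_matrix U}"
    unfolding closed_sequential_limits orthogonal_matrix by blast
qed

text \<open>Eigenvectors need not depend continuously on the matrix, but orthogonal eigenbases of a
  convergent sequence accumulate at eigenbases of the limit.\<close>

lemma continuous_on_mat_powr: "continuous_on {A :: real^'d^'d. pos_def A} (\<lambda>A. mat_powr A t)"
proof (rule continuous_on_sequentiallyI)
  fix u :: "nat \<Rightarrow> real^'d^'d" and A
  assume u: "\<forall>n. u n \<in> {A. pos_def A}" and A: "A \<in> {A. pos_def A}" and lim: "u \<longlonglongrightarrow> A"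
  have "\<exists>U l. orthogonal_matrix U \<and> u n = U ** diag l ** transpose U" for n
    using u symmetric_diagonalization[of "u n"] by (metis mem_Collect_eq pos_def_def)
  then obtain U l where U: "\<And>n. orthogonal_matrix (U n)"
    and ul: "\<And>n. u n = U n ** diag (l n) ** transpose (U n)" by metis
  show "(\<lambda>n. mat_powr (u n) t) \<longlonglongrightarrow> mat_powr A t"
  proof (rule LIMSEQ_if_subsubsequences)
    fix r :: "nat \<Rightarrow> nat" assume r: "strict_mono r"
    have "seq_compact {U :: real^'d^'d. orthogonal_matrix U}"
      using compact_orthogonal_matrices compact_imp_seq_compact by blast
    moreover have "\<forall>n. (U \<circ> r) n \<in> {U. orthogonal_matrix U}" using U by simp
    ultimately obtain V s where V: "orthogonal_matrix V" and s: "strict_mono s"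
      and limU: "(U \<circ> r \<circ> s) \<longlonglongrightarrow> V"
      by (rule seq_compactE) (rule that, auto simp: comp_def)
    define q where "q n = r (s n)" for n
    have limU: "(\<lambda>n. U (q n)) \<longlonglongrightarrow> V" using limU by (simp add: q_def comp_def)
    have "(\<lambda>n. u (q n)) \<longlonglongrightarrow> A"
      using LIMSEQ_subseq_LIMSEQ[OF LIMSEQ_subseq_LIMSEQ[OF lim r] s] by (simp add: q_def comp_def)
    then have "(\<lambda>n. transpose (U (q n)) ** u (q n) ** U (q n)) \<longlonglongrightarrow> transpose V ** A ** V"
      by (intro tendsto_matrix_mult tendsto_transpose limU)
    moreover have "transpose (U n) ** u n ** U n = diag (l n)" for n
    proof -
      have "transpose (U n) ** U n = mat 1" using U by (simp add: orthogonal_matrix_def)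
      then have "transpose (U n) ** (U n ** X) = X" for X :: "real^'d^'d"
        by (simp add: matrix_mul_assoc)
      then show ?thesis
        using \<open>transpose (U n) ** U n = mat 1\<close> by (simp add: ul flip: matrix_mul_assoc)
    qed
    ultimately have limd: "(\<lambda>n. diag (l (q n))) \<longlonglongrightarrow> transpose V ** A ** V" by simp
    \<comment> \<open>Once the eigenbases converge, the eigenvalues do too, as diagonal entries of
      the conjugated matrices.\<close>
    define m where "m = (\<chi> i. (transpose V ** A ** V) $ i $ i)"
    have liml: "(\<lambda>n. l (q n) $ i) \<longlonglongrightarrow> m $ i" for i
    proof -
      have "(\<lambda>n. diag (l (q n)) $ i $ i) \<longlonglongrightarrow> (transpose V ** A ** V) $ i $ i"
        by (intro tendsto_vec_nth limd)
      then show ?thesis by (simp add: diag_def m_def)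
    qed
    have "(\<lambda>n. u (q n)) \<longlonglongrightarrow> V ** diag m ** transpose V"
      unfolding ul by (intro tendsto_matrix_mult tendsto_transpose tendsto_diag limU liml)
    then have Am: "A = V ** diag m ** transpose V"
      using \<open>(\<lambda>n. u (q n)) \<longlonglongrightarrow> A\<close> LIMSEQ_unique by blast
    \<comment> \<open>The exponent may be negative, so continuity of \<open>powr\<close> requires
      the limiting eigenvalues to stay away from 0.\<close>
    have m: "0 < m $ i" for i
      using A V by (simp add: Am pos_def_orthogonal_diag_iff)
    have "(\<lambda>n. diag (\<chi> i. l (q n) $ i powr t)) \<longlonglongrightarrow> diag (\<chi> i. m $ i powr t)"
    proof (rule tendsto_diag)
      fix i
      have "(\<lambda>n. l (q n) $ i powr t) \<longlonglongrightarrow> m $ i powr t"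
        using m[of i] by (intro tendsto_powr liml tendsto_const) simp
      then show "(\<lambda>n. (\<chi> i. l (q n) $ i powr t) $ i) \<longlonglongrightarrow> (\<chi> i. m $ i powr t) $ i" by simp
    qed
    then have "(\<lambda>n. U (q n) ** diag (\<chi> i. l (q n) $ i powr t) ** transpose (U (q n)))
      \<longlonglongrightarrow> V ** diag (\<chi> i. m $ i powr t) ** transpose V"
      by (intro tendsto_matrix_mult tendsto_transpose limU)
    then show "\<exists>s. strict_mono s \<and> ((\<lambda>n. mat_powr (u n) t) \<circ> r \<circ> s) \<longlonglongrightarrow> mat_powr A t"
      using s by (auto simp: comp_def q_def ul Am mat_powr_diagonalization U V)
  qed
qed

text \<open>Off a null set the composite is measurable by continuity on \<open>A\<close>. On the
  null set its values are arbitrary, and completeness of Lebesgue measure makes every subset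
  measurable.\<close>

lemma borel_measurable_lebesgue_AE_on:
  fixes f :: "'a::euclidean_space \<Rightarrow> 'b::topological_space" and g :: "'b \<Rightarrow> 'c::topological_space"
  assumes f: "f \<in> borel_measurable lebesgue" and g: "continuous_on A g"
    and AE: "AE x in lebesgue. f x \<in> A"
  shows "(\<lambda>x. g (f x)) \<in> borel_measurable lebesgue"
proof (rule measurableI)
  fix B :: "'c set" assume B: "B \<in> sets borel"
  obtain N where N: "{x. f x \<notin> A} \<subseteq> N" "N \<in> null_sets lebesgue"
    using AE by (auto elim!: AE_E simp: null_sets_def)
  have "f \<in> measurable (restrict_space lebesgue (- N)) (restrict_space borel A)"
    using N f by (intro measurable_restrict_space3) auto
  then have "(\<lambda>x. g (f x)) \<in> borel_measurable (restrict_space lebesgue (- N))"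
    using borel_measurable_continuous_on_restrict[OF g] by (rule measurable_compose)
  then have "(\<lambda>x. g (f x)) -` B \<inter> space (restrict_space lebesgue (- N)) \<in> sets (restrict_space lebesgue (- N))"
    using B by (rule measurable_sets)
  moreover have mN: "- N \<in> sets lebesgue"
    using N(2) sets.compl_sets[of N lebesgue] by (auto simp: Compl_eq_Diff_UNIV)
  ultimately have 1: "(\<lambda>x. g (f x)) -` B \<inter> - N \<in> sets lebesgue"
    by (simp add: sets_restrict_space_iff space_restrict_space)
  have "(\<lambda>x. g (f x)) -` B \<inter> N \<subseteq> N" by blast
  then have 2: "(\<lambda>x. g (f x)) -` B \<inter> N \<in> sets lebesgue"
    using N(2) by (metis null_sets_completion_subset null_setsD2)
  have eq: "(\<lambda>x. g (f x)) -` B = ((\<lambda>x. g (f x)) -` B \<inter> - N) \<union> ((\<lambda>x. g (f x)) -` B \<inter> N)" by blast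
  have "(\<lambda>x. g (f x)) -` B \<in> sets lebesgue"
    by (subst eq) (rule sets.Un[OF 1 2])
  then show "(\<lambda>x. g (f x)) -` B \<inter> space lebesgue \<in> sets lebesgue" by simp
qed simp

lemma borel_measurable_mat_powr:
  assumes "f \<in> borel_measurable lebesgue" "AE x in lebesgue. pos_def (f x)"
  shows "(\<lambda>x. mat_powr (f x) t) \<in> borel_measurable lebesgue"
  by (rule borel_measurable_lebesgue_AE_on[OF assms(1) continuous_on_mat_powr]) (use assms(2) in simp)

lemma borel_measurable_matrix_mult:
  fixes f g :: "'a \<Rightarrow> real^'d^'d"
  assumes "f \<in> borel_measurable M" "g \<in> borel_measurable M"
  shows "(\<lambda>x. f x ** g x) \<in> borel_measurable M"
  using assms
proof (rule borel_measurable_continuous_Pair)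
  show "continuous_on UNIV (\<lambda>x. fst x ** snd x :: real^'d^'d)"
    unfolding matrix_matrix_mult_def by (intro continuous_intros)
qed

lemma borel_measurable_geom_mean:
  assumes f: "f \<in> borel_measurable lebesgue" and g: "g \<in> borel_measurable lebesgue"
    and pdf: "AE x in lebesgue. pos_def (f x)" and pdg: "AE x in lebesgue. pos_def (g x)"
  shows "(\<lambda>x. geom_mean t (f x) (g x)) \<in> borel_measurable lebesgue"
  unfolding geom_mean_def
proof (intro borel_measurable_matrix_mult borel_measurable_mat_powr f g pdf)
  show "AE x in lebesgue. pos_def (mat_powr (f x) (-1/2) ** g x ** mat_powr (f x) (-1/2))"
    using pdf pdg by eventually_elim (intro pos_def_sandwich pos_def_mat_powr)
qed

lemma matrix_weight_geom_mean:
  fixes W0 W1 :: "real^'n \<Rightarrow> real^'d^'d"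
  assumes W0: "matrix_weight W0" and W1: "matrix_weight W1"
  shows "matrix_weight (\<lambda>x. mat_powr (geom_mean t (W0 x ** W0 x) (W1 x ** W1 x)) (1/2))"
  unfolding matrix_weight_def
proof (intro conjI allI)
  have pd: "AE x in lebesgue. pos_def (W0 x)" "AE x in lebesgue. pos_def (W1 x)"
    and meas: "W0 \<in> borel_measurable lebesgue" "W1 \<in> borel_measurable lebesgue"
    and psd: "\<And>x. pos_semidef (W0 x)" "\<And>x. pos_semidef (W1 x)"
    using W0 W1 by (auto simp: matrix_weight_def)
  have sq: "AE x in lebesgue. pos_def (W0 x ** W0 x)"
    using pd(1) by eventually_elim (rule pos_def_square)
  have sq': "AE x in lebesgue. pos_def (W1 x ** W1 x)"
    using pd(2) by eventually_elim (rule pos_def_square)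
  have gm: "AE x in lebesgue. pos_def (geom_mean t (W0 x ** W0 x) (W1 x ** W1 x))"
    using sq sq' by eventually_elim (rule pos_def_geom_mean)
  then show "AE x in lebesgue. pos_def (mat_powr (geom_mean t (W0 x ** W0 x) (W1 x ** W1 x)) (1/2))"
    by eventually_elim (rule pos_def_mat_powr)
  show "(\<lambda>x. mat_powr (geom_mean t (W0 x ** W0 x) (W1 x ** W1 x)) (1/2)) \<in> borel_measurable lebesgue"
    by (intro borel_measurable_mat_powr borel_measurable_geom_mean borel_measurable_matrix_mult
        meas sq sq' gm)
  show "pos_semidef (mat_powr (geom_mean t (W0 x ** W0 x) (W1 x ** W1 x)) (1/2))" for x
    using psd by (intro pos_semidef_mat_powr pos_semidef_symmetric pos_semidef_geom_mean pos_semidef_square) auto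
qed

section \<open>Averages and the Muckenhoupt conditions\<close>

text \<open>The integral is a supremum over simple functions below the integrand, and scaling
  carries these to each other. Stated for arbitrary \<open>f\<close>, it applies to operator norms
  involving \<open>matrix_inv\<close>.\<close>

lemma nn_integral_cmult_le:
  assumes "0 \<le> c" shows "(\<integral>\<^sup>+x. ennreal c * f x \<partial>M) \<le> ennreal c * integral\<^sup>N M f"
proof (cases "c = 0")
  case False
  then have c: "0 < c" using assms by simp
  show ?thesis
    unfolding nn_integral_def[of M "\<lambda>x. ennreal c * f x"]
  proof (rule SUP_least, safe)
    fix g assume g: "simple_function M g" "g \<le> (\<lambda>x. ennreal c * f x)"
    have cancel: "ennreal c * (ennreal (1 / c) * z) = z" "ennreal (1 / c) * (ennreal c * z) = z" for z
      using c by (simp_all add: mult.assoc[symmetric] ennreal_mult[symmetric])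
    have "integral\<^sup>S M g = (\<integral>\<^sup>+x. ennreal c * (ennreal (1 / c) * g x) \<partial>M)"
      using g(1) by (simp add: cancel nn_integral_eq_simple_integral)
    also have "\<dots> = ennreal c * (\<integral>\<^sup>+x. ennreal (1 / c) * g x \<partial>M)"
      using borel_measurable_simple_function[OF g(1)] by (intro nn_integral_cmult) measurable
    also have "\<dots> \<le> ennreal c * integral\<^sup>N M f"
    proof (intro mult_left_mono nn_integral_mono)
      fix x
      have "ennreal (1 / c) * g x \<le> ennreal (1 / c) * (ennreal c * f x)"
        using g(2) by (intro mult_left_mono) (auto simp: le_fun_def)
      then show "ennreal (1 / c) * g x \<le> f x" by (simp only: cancel)
    qed simp
    finally show "integral\<^sup>S M g \<le> ennreal c * integral\<^sup>N M f" .
  qed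
qed simp

lemma cubes_measurable: "Q \<in> cubes \<Longrightarrow> Q \<in> sets lebesgue"
  by (auto simp: cubes_def)

lemma emeasure_cube:
  fixes Q :: "(real^'n) set"
  assumes "Q \<in> cubes" shows "emeasure lebesgue Q \<noteq> 0" "emeasure lebesgue Q \<noteq> \<infinity>"
proof -
  obtain a :: "real^'n" and s where s: "0 < s" and Q: "Q = cbox a (\<chi> i. a $ i + s)"
    using assms by (auto simp: cubes_def)
  have "box a (\<chi> i. a $ i + s) \<noteq> {}"
    using s by (auto simp: box_ne_empty Basis_vec_def inner_axis)
  then have "0 < measure lborel Q" unfolding Q by (simp add: content_pos_lt_eq box_ne_empty)
  then show "emeasure lebesgue Q \<noteq> 0" by (auto simp: measure_def Q)
  show "emeasure lebesgue Q \<noteq> \<infinity>"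
    using emeasure_lborel_cbox_finite[of a "\<chi> i. a $ i + s"] by (simp add: Q)
qed

lemma average_mono_AE:
  assumes "AE x in lebesgue. x \<in> Q \<longrightarrow> f x \<le> g x"
  shows "average Q f \<le> average Q g"
  unfolding average_def
  by (intro divide_right_mono_ennreal nn_integral_mono_AE, rule eventually_mono[OF assms])
    (auto simp: indicator_def)

lemma average_cmult_le: "0 \<le> c \<Longrightarrow> average Q (\<lambda>x. ennreal c * f x) \<le> ennreal c * average Q f"
  using divide_right_mono_ennreal[OF nn_integral_cmult_le[where f = "\<lambda>x. f x * indicator Q x" and M = lebesgue]]
  by (simp add: average_def mult.assoc ennreal_times_divide)

text \<open>Additivity is applied only to functions |W v| with v fixed, whose measurability is
  immediate.\<close>

lemma average_add:
  assumes "f \<in> borel_measurable lebesgue" "g \<in> borel_measurable lebesgue" "Q \<in> cubes"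
  shows "average Q (\<lambda>x. f x + g x) = average Q f + average Q g"
proof -
  have [measurable]: "Q \<in> sets lebesgue" using assms cubes_measurable by blast
  have "(\<integral>\<^sup>+x. (f x + g x) * indicator Q x \<partial>lebesgue)
    = (\<integral>\<^sup>+x. f x * indicator Q x \<partial>lebesgue) + (\<integral>\<^sup>+x. g x * indicator Q x \<partial>lebesgue)"
    unfolding distrib_right
    by (intro nn_integral_add borel_measurable_times_ennreal assms(1,2) borel_measurable_indicator) fact+
  then show ?thesis by (simp add: average_def add_divide_distrib_ennreal)
qed

lemma average_sum:
  assumes "finite I" "\<And>i. i \<in> I \<Longrightarrow> f i \<in> borel_measurable lebesgue" "Q \<in> cubes"
  shows "average Q (\<lambda>x. \<Sum>i\<in>I. f i x) = (\<Sum>i\<in>I. average Q (f i))"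
  using assms(1,2)
proof (induction I)
  case empty
  then show ?case by (simp add: average_def)
next
  case (insert i I)
  then have "average Q (\<lambda>x. f i x + (\<Sum>i\<in>I. f i x)) = average Q (f i) + average Q (\<lambda>x. \<Sum>i\<in>I. f i x)"
    by (intro average_add assms(3) borel_measurable_sum) auto
  then show ?case using insert by simp
qed

lemma enn_powr_mono: "0 < r \<Longrightarrow> x \<le> y \<Longrightarrow> enn_powr x r \<le> enn_powr y r"
  by (auto simp: enn_powr_def top_unique intro!: ennreal_leI powr_mono2 enn2real_mono simp: less_top)

lemma enn_powr_ennreal: "0 \<le> x \<Longrightarrow> enn_powr (ennreal x) r = ennreal (x powr r)"
  by (simp add: enn_powr_def)

lemma SUP_esssup_AE:
  assumes "(SUP Q\<in>cubes. esssup (lebesgue_on Q) (F Q)) = (C :: ennreal)" "Q \<in> cubes"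
  shows "AE x in lebesgue. x \<in> Q \<longrightarrow> F Q x \<le> C"
proof -
  have "AE x in lebesgue_on Q. F Q x \<le> esssup (lebesgue_on Q) (F Q)" by (rule esssup_AE)
  then have "AE x in lebesgue. x \<in> Q \<longrightarrow> F Q x \<le> esssup (lebesgue_on Q) (F Q)"
    using cubes_measurable[OF assms(2)] by (simp add: AE_restrict_space_iff)
  moreover have "esssup (lebesgue_on Q) (F Q) \<le> C"
    using assms by (auto intro: SUP_upper)
  ultimately show ?thesis
    by (auto elim!: eventually_mono intro: order_trans)
qed

lemma borel_measurable_norm_mult_vec:
  fixes W :: "'a \<Rightarrow> real^'n^'m"
  assumes "W \<in> borel_measurable M"
  shows "(\<lambda>x. ennreal (norm (W x *v v))) \<in> borel_measurable M"
proof -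
  have "continuous_on UNIV (\<lambda>A :: real^'n^'m. norm (A *v v))"
    unfolding matrix_vector_mult_def
    by (intro continuous_on_norm continuous_on_vec_lambda continuous_on_sum continuous_on_mult
        continuous_on_component continuous_on_id continuous_on_const)
  then show ?thesis
    using assms by (intro measurable_compose[OF _ measurable_ennreal]
        measurable_compose[OF assms borel_measurable_continuous_onI])
qed

text \<open>The matrix \<open>E\<close> is an inverse reducing matrix of \<open>W\<close> on \<open>Q\<close>: up to dimensional constants,
  \<open>\<bar>E\<^sup>-\<^sup>1 v\<bar>\<close> is the average of \<open>\<bar>W v\<bar>\<close> over \<open>Q\<close>.\<close>

lemma A1_reducing_matrix:
  fixes W :: "real^'n \<Rightarrow> real^'d^'d" and c :: real
  assumes W: "matrix_weight W" and Q: "Q \<in> cubes" and c: "0 \<le> c"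
    and A1: "AE y in lebesgue. y \<in> Q \<longrightarrow>
      average Q (\<lambda>x. ennreal (op_norm (matrix_inv (W y) ** W x))) \<le> ennreal c"
  obtains E :: "real^'d^'d" where
    "AE y in lebesgue. y \<in> Q \<longrightarrow> (\<forall>x. op_norm (W x ** matrix_inv (W y))
      \<le> CARD('d) * c * (\<Sum>j\<in>UNIV. norm (W x *v column j E)))"
    "average Q (\<lambda>x. ennreal (\<Sum>j\<in>UNIV. norm (W x *v column j E))) \<le> ennreal CARD('d)"
proof -
  have psd: "\<And>x. pos_semidef (W x)" and meas: "W \<in> borel_measurable lebesgue"
    and pd: "AE x in lebesgue. pos_def (W x)" using W by (auto simp: matrix_weight_def)
  note [measurable] = cubes_measurable[OF Q]
  define N where "N v = average Q (\<lambda>x. ennreal (norm (W x *v v)))" for v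
  have measN: "(\<lambda>x. ennreal (norm (W x *v v))) \<in> borel_measurable lebesgue" for v
    by (rule borel_measurable_norm_mult_vec[OF meas])
  have good: "AE y in lebesgue. y \<in> Q \<longrightarrow> pos_def (W y) \<and>
    average Q (\<lambda>x. ennreal (op_norm (matrix_inv (W y) ** W x))) \<le> ennreal c"
    using A1 pd by eventually_elim blast
  \<comment> \<open>The A_1 condition read as a norm comparison: at almost every point of
    \<open>Q\<close>, N(v) <= c |W(y) v|.\<close>
  have N_inv: "N (matrix_inv (W y) *v u) \<le> ennreal (c * norm u)"
    if "pos_def (W y)" "average Q (\<lambda>x. ennreal (op_norm (matrix_inv (W y) ** W x))) \<le> ennreal c" for y u
  proof -
    have "norm (W x *v (matrix_inv (W y) *v u)) \<le> norm u * op_norm (matrix_inv (W y) ** W x)" for x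
      using norm_le_op_norm[of "W x ** matrix_inv (W y)" u] that(1) psd
      by (simp add: op_norm_inv_mult_flip pos_semidef_symmetric pos_def_invertible
          matrix_vector_mul_assoc mult.commute)
    then have "N (matrix_inv (W y) *v u)
        \<le> average Q (\<lambda>x. ennreal (norm u) * ennreal (op_norm (matrix_inv (W y) ** W x)))"
      unfolding N_def
      by (intro average_mono_AE always_eventually allI impI) (simp add: ennreal_leI flip: ennreal_mult')
    also have "\<dots> \<le> ennreal (norm u) * average Q (\<lambda>x. ennreal (op_norm (matrix_inv (W y) ** W x)))"
      by (rule average_cmult_le) simp
    also have "\<dots> \<le> ennreal (norm u) * ennreal c" by (intro mult_left_mono that) simp
    finally show ?thesis using c by (simp add: ennreal_mult' mult.commute)
  qed
  have Nfin: "N v < \<infinity>" for v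
  proof -
    \<comment> \<open>One good point suffices for finiteness of \<open>N\<close>, and it exists
      because a cube has positive measure.\<close>
    have "\<exists>y. pos_def (W y) \<and> average Q (\<lambda>x. ennreal (op_norm (matrix_inv (W y) ** W x))) \<le> ennreal c"
    proof (rule ccontr)
      assume "\<not> ?thesis"
      then have "AE y in lebesgue. y \<notin> Q" using good by (auto elim!: eventually_mono)
      then have "emeasure lebesgue Q = 0"
        by (subst (asm) AE_iff_measurable[of Q]) auto
      then show False using emeasure_cube[OF Q] by simp
    qed
    then obtain y where y: "pos_def (W y)"
      "average Q (\<lambda>x. ennreal (op_norm (matrix_inv (W y) ** W x))) \<le> ennreal c" by blast
    have "N v = N (matrix_inv (W y) *v (W y *v v))"
      by (simp only: matrix_inv_cancel(4)[OF pos_def_invertible[OF y(1)]])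
    also have "\<dots> \<le> ennreal (c * norm (W y *v v))" by (rule N_inv[OF y])
    finally show ?thesis by (simp add: order_le_less_trans)
  qed
  then have N_eq: "N v = ennreal (enn2real (N v))" for v by simp
  have tri: "enn2real (N (v + w)) \<le> enn2real (N v) + enn2real (N w)" for v w
  proof -
    have "N (v + w) \<le> average Q (\<lambda>x. ennreal (norm (W x *v v)) + ennreal (norm (W x *v w)))"
      unfolding N_def
      by (intro average_mono_AE always_eventually allI impI)
        (simp add: matrix_vector_right_distrib norm_triangle_ineq ennreal_leI flip: ennreal_plus)
    also have "\<dots> = N v + N w" unfolding N_def by (intro average_add measN Q)
    finally have "enn2real (N (v + w)) \<le> enn2real (N v + N w)"
      using Nfin by (intro enn2real_mono) auto
    then show ?thesis using Nfin by (simp add: enn2real_plus)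
  qed
  have hom_le: "enn2real (N (r *\<^sub>R v)) \<le> \<bar>r\<bar> * enn2real (N v)" for r v
  proof -
    have "N (r *\<^sub>R v) = average Q (\<lambda>x. ennreal \<bar>r\<bar> * ennreal (norm (W x *v v)))"
      unfolding N_def by (simp add: matrix_vector_mult_scaleR ennreal_mult)
    also have "\<dots> \<le> ennreal \<bar>r\<bar> * N v" unfolding N_def by (rule average_cmult_le) simp
    finally have "enn2real (N (r *\<^sub>R v)) \<le> enn2real (ennreal \<bar>r\<bar> * N v)"
      using Nfin[of v] by (intro enn2real_mono) (auto simp: ennreal_mult_less_top)
    then show ?thesis by (simp add: enn2real_mult)
  qed
  \<comment> \<open>Scaling by r and then by 1/r upgrades the inequality to equality.\<close>
  have hom: "enn2real (N (r *\<^sub>R v)) = \<bar>r\<bar> * enn2real (N v)" for r v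
  proof (cases "r = 0")
    case False
    have "\<bar>r\<bar> * enn2real (N v) = \<bar>r\<bar> * enn2real (N ((1 / r) *\<^sub>R (r *\<^sub>R v)))" using False by simp
    also have "\<dots> \<le> \<bar>r\<bar> * (\<bar>1 / r\<bar> * enn2real (N (r *\<^sub>R v)))" by (intro mult_left_mono hom_le) simp
    also have "\<dots> = enn2real (N (r *\<^sub>R v))" using False by simp
    finally show ?thesis using hom_le[of r v] by simp
  qed (use hom_le[of 0 v] enn2real_nonneg[of "N 0"] in simp)
  have pos: "0 < enn2real (N v)" if "v \<noteq> 0" for v
  proof -
    have "N v \<noteq> 0"
    proof
      assume "N v = 0"
      then have "(\<integral>\<^sup>+x. ennreal (norm (W x *v v)) * indicator Q x \<partial>lebesgue) = 0"
        using emeasure_cube[OF Q] by (simp add: N_def average_def ennreal_divide_eq_0_iff)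
      moreover have "(\<lambda>x. ennreal (norm (W x *v v)) * indicator Q x) \<in> borel_measurable lebesgue"
        using measN by measurable
      ultimately have "AE x in lebesgue. ennreal (norm (W x *v v)) * indicator Q x = 0"
        by (simp only: nn_integral_0_iff_AE)
      then have "AE x in lebesgue. x \<notin> Q"
        using pd
      proof eventually_elim
        case (elim x)
        then have "W x *v v \<noteq> 0"
          using that pos_def_invertible invertible_mult_vec_eq_0 by blast
        then show ?case using elim by (auto simp: indicator_def)
      qed
      then have "emeasure lebesgue Q = 0"
        by (subst (asm) AE_iff_measurable[of Q]) auto
      then show False using emeasure_cube[OF Q] by simp
    qed
    then show ?thesis using Nfin[of v] by (simp add: enn2real_positive_iff zero_less_iff_neq_zero)
  qed
  obtain E :: "real^'d^'d" where E: "invertible E" "\<And>j. enn2real (N (column j E)) \<le> 1"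
    "\<And>v i. \<bar>v $ i\<bar> \<le> enn2real (N (E *v v))"
    by (rule Auerbach_basis[of "\<lambda>v. enn2real (N v)", OF tri hom pos]) (assumption | rule that)+
  show thesis
  proof
    show "AE y in lebesgue. y \<in> Q \<longrightarrow> (\<forall>x. op_norm (W x ** matrix_inv (W y))
      \<le> CARD('d) * c * (\<Sum>j\<in>UNIV. norm (W x *v column j E)))"
      using good
    proof eventually_elim
      case (elim y)
      show ?case
      proof (intro impI allI)
        fix x assume yQ: "y \<in> Q"
        \<comment> \<open>The coordinates of \<open>Z *v u\<close> in the Auerbach basis are at most
          N(W(y)^-1 u) <= c |u|. Summing their absolute values gives the first factor d.\<close>
        define Z where "Z = matrix_inv E ** matrix_inv (W y)"
        have Z: "op_norm Z \<le> CARD('d) * c"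
        proof (rule op_norm_le)
          fix u
          have EZ: "E *v (Z *v u) = matrix_inv (W y) *v u"
            unfolding Z_def matrix_vector_mul_assoc[symmetric] matrix_inv_cancel(3)[OF E(1)] ..
          have "enn2real (N (matrix_inv (W y) *v u)) \<le> c * norm u"
            using N_inv[of y u] elim yQ c by (intro enn2real_leI) auto
          then have "\<bar>(Z *v u) $ i\<bar> \<le> c * norm u" for i
            using E(3)[of "Z *v u" i] by (simp only: EZ)
          then have "(\<Sum>i\<in>UNIV. \<bar>(Z *v u) $ i\<bar>) \<le> (\<Sum>i\<in>(UNIV :: 'd set). c * norm u)"
            by (intro sum_mono)
          then show "norm (Z *v u) \<le> CARD('d) * c * norm u"
            using norm_le_l1_cart[of "Z *v u"] by simp
        qed (use c in simp)
        have "W x ** matrix_inv (W y) = (W x ** E) ** Z"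
          unfolding Z_def matrix_mul_assoc matrix_inv_cancel(6)[OF E(1)] ..
        then have "op_norm (W x ** matrix_inv (W y)) \<le> op_norm (W x ** E) * op_norm Z"
          using op_norm_mult_le by metis
        also have "\<dots> \<le> (\<Sum>j\<in>UNIV. norm (column j (W x ** E))) * (CARD('d) * c)"
          by (intro mult_mono op_norm_le_sum_columns Z sum_nonneg op_norm_nonneg) simp
        also have "(\<lambda>j. column j (W x ** E)) = (\<lambda>j. W x *v column j E)"
          by (simp add: column_def matrix_matrix_mult_def matrix_vector_mult_def vec_eq_iff fun_eq_iff)
        finally show "op_norm (W x ** matrix_inv (W y)) \<le> CARD('d) * c * (\<Sum>j\<in>UNIV. norm (W x *v column j E))"
          by (simp add: mult.commute)
      qed
    qed
    \<comment> \<open>The d columns each have \<open>N\<close> at most one; this is the second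
      factor d.\<close>
    have "average Q (\<lambda>x. ennreal (\<Sum>j\<in>UNIV. norm (W x *v column j E)))
      = (\<Sum>j\<in>UNIV. N (column j E))"
      unfolding N_def by (subst average_sum[symmetric]) (auto simp: measN Q sum_ennreal)
    also have "\<dots> \<le> (\<Sum>j\<in>(UNIV :: 'd set). 1)"
    proof (rule sum_mono)
      show "N (column j E) \<le> 1" for j
        using E(2)[of j] by (subst N_eq) (simp flip: ennreal_1 add: ennreal_leI)
    qed
    finally show "average Q (\<lambda>x. ennreal (\<Sum>j\<in>UNIV. norm (W x *v column j E))) \<le> ennreal CARD('d)"
      by (simp add: ennreal_of_nat_eq_real_of_nat)
  qed
qed

section \<open>Combination of the A_1 and A_infinity conditions\<close>

theorem geom_mean_in_class_Ap:
  fixes W0 W1 :: "real^'n \<Rightarrow> real^'d^'d"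
  assumes A1: "W0 \<in> class_A1" and Ainf: "W1 \<in> class_Ainf" and p: "1 < p"
  shows "(\<lambda>x. mat_powr (geom_mean (1 / conj_exp p) (W0 x ** W0 x) (W1 x ** W1 x)) (1/2)) \<in> class_Ap p"
proof -
  define q where "q = conj_exp p"
  have q: "1 < q" and pq: "1 / p + 1 / q = 1"
    using p conj_exp[OF p] by (auto simp: q_def conj_exp_def)
  define t where "t = 1 / q"
  have t: "0 < t" "t < 1" "1 - t = 1 / p" "t * q = 1" using q pq by (auto simp: t_def)
  define V where "V x = mat_powr (geom_mean t (W0 x ** W0 x) (W1 x ** W1 x)) (1/2)" for x
  have W0: "matrix_weight W0" and W1: "matrix_weight W1"
    using A1 Ainf by (auto simp: class_A1_def class_Ainf_def)
  have pd: "AE x in lebesgue. pos_def (W0 x)" "AE x in lebesgue. pos_def (W1 x)"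
    using W0 W1 by (auto simp: matrix_weight_def)
  define c0 where "c0 = enn2real (A1_const W0)"
  define c1 where "c1 = enn2real (Ainf_const W1)"
  have c0: "A1_const W0 = ennreal c0" "0 \<le> c0" and c1: "Ainf_const W1 = ennreal c1" "0 \<le> c1"
    using A1 Ainf by (auto simp: class_A1_def class_Ainf_def c0_def c1_def)
  define d where "d = real CARD('d)"
  \<comment> \<open>The inner average contributes [W1], later raised to p/q; the majorant of the W0
    factor contributes d [W0].\<close>
  define K where "K = c1 powr (p / q) * (d * c0)"
  have K: "0 \<le> K" using c0 by (simp add: K_def d_def)
  have "enn_powr (average Q (\<lambda>x. enn_powr
      (average Q (\<lambda>y. ennreal (op_norm (V x ** matrix_inv (V y)) powr q))) (p / q))) (1 / p)
    \<le> ennreal ((K * d) powr (1 / p))" if Q: "Q \<in> cubes" for Q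
  proof -
    \<comment> \<open>The roles of the variables are opposite: the essential supremum runs over y
      here and over x in \<open>AinfQ\<close>.\<close>
    have A1Q: "AE y in lebesgue. y \<in> Q \<longrightarrow>
      average Q (\<lambda>x. ennreal (op_norm (matrix_inv (W0 y) ** W0 x))) \<le> ennreal c0"
      using SUP_esssup_AE[OF c0(1)[unfolded A1_const_def] Q] .
    have AinfQ: "AE x in lebesgue. x \<in> Q \<longrightarrow>
      average Q (\<lambda>y. ennreal (op_norm (W1 x ** matrix_inv (W1 y)))) \<le> ennreal c1"
      using SUP_esssup_AE[OF c1(1)[unfolded Ainf_const_def] Q] .
    obtain E :: "real^'d^'d" where
      E: "AE y in lebesgue. y \<in> Q \<longrightarrow> (\<forall>x. op_norm (W0 x ** matrix_inv (W0 y))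
        \<le> CARD('d) * c0 * (\<Sum>j\<in>UNIV. norm (W0 x *v column j E)))"
      and avgE: "average Q (\<lambda>x. ennreal (\<Sum>j\<in>UNIV. norm (W0 x *v column j E))) \<le> ennreal CARD('d)"
      using A1_reducing_matrix[OF W0 Q c0(2) A1Q] .
    define g where "g x = (\<Sum>j\<in>UNIV. norm (W0 x *v column j E))" for x
    \<comment> \<open>Majorant of |W0(x) W0(y)^-1| for almost every y in \<open>Q\<close>; being
      free of y, it can leave the inner average.\<close>
    define h where "h x = d * c0 * g x" for x
    have g: "0 \<le> g x" for x by (simp add: g_def sum_nonneg)
    then have h: "0 \<le> h x" for x using c0 by (simp add: h_def d_def)
    have inner: "average Q (\<lambda>y. ennreal (op_norm (V x ** matrix_inv (V y)) powr q))
        \<le> ennreal (h x powr (q / p) * c1)"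
      if "pos_def (W0 x)" "pos_def (W1 x)"
        "average Q (\<lambda>y. ennreal (op_norm (W1 x ** matrix_inv (W1 y)))) \<le> ennreal c1" for x
    proof -
      have "average Q (\<lambda>y. ennreal (op_norm (V x ** matrix_inv (V y)) powr q))
        \<le> average Q (\<lambda>y. ennreal (h x powr (q / p)) * ennreal (op_norm (W1 x ** matrix_inv (W1 y))))"
      proof (rule average_mono_AE)
        show "AE y in lebesgue. y \<in> Q \<longrightarrow> ennreal (op_norm (V x ** matrix_inv (V y)) powr q)
          \<le> ennreal (h x powr (q / p)) * ennreal (op_norm (W1 x ** matrix_inv (W1 y)))"
          using E pd
        proof eventually_elim
          case (elim y)
          show ?case
          proof
            assume yQ: "y \<in> Q"
            let ?a = "op_norm (W0 x ** matrix_inv (W0 y))" and ?b = "op_norm (W1 x ** matrix_inv (W1 y))"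
            have "op_norm (V x ** matrix_inv (V y)) powr q \<le> (?a powr (1 - t) * ?b powr t) powr q"
              unfolding V_def using elim that t q
              by (intro powr_mono2 op_norm_geom_mean_interpolation op_norm_nonneg) auto
            \<comment> \<open>Since t q = 1 and (1 - t) q = q/p, the W1 factor enters
              linearly.\<close>
            also have "\<dots> = ?a powr (q / p) * ?b"
              using t op_norm_nonneg[of "W1 x ** matrix_inv (W1 y)"] by (simp add: powr_mult powr_powr)
            also have "\<dots> \<le> h x powr (q / p) * ?b"
              using elim yQ p q
              by (intro mult_right_mono powr_mono2 op_norm_nonneg) (auto simp: h_def g_def d_def)
            finally show "ennreal (op_norm (V x ** matrix_inv (V y)) powr q)
                \<le> ennreal (h x powr (q / p)) * ennreal ?b"
              by (simp add: ennreal_leI flip: ennreal_mult')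
          qed
        qed
      qed
      also have "\<dots> \<le> ennreal (h x powr (q / p)) * average Q (\<lambda>y. ennreal (op_norm (W1 x ** matrix_inv (W1 y))))"
        by (rule average_cmult_le) simp
      also have "\<dots> \<le> ennreal (h x powr (q / p)) * ennreal c1"
        by (intro mult_left_mono that) simp
      finally show ?thesis using c1 by (simp add: ennreal_mult')
    qed
    have "average Q (\<lambda>x. enn_powr
        (average Q (\<lambda>y. ennreal (op_norm (V x ** matrix_inv (V y)) powr q))) (p / q))
      \<le> average Q (\<lambda>x. ennreal K * ennreal (g x))"
    proof (rule average_mono_AE)
      show "AE x in lebesgue. x \<in> Q \<longrightarrow> enn_powr
          (average Q (\<lambda>y. ennreal (op_norm (V x ** matrix_inv (V y)) powr q))) (p / q)
        \<le> ennreal K * ennreal (g x)"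
        using AinfQ pd
      proof eventually_elim
        case (elim x)
        show ?case
        proof
          assume xQ: "x \<in> Q"
          have "enn_powr (average Q (\<lambda>y. ennreal (op_norm (V x ** matrix_inv (V y)) powr q))) (p / q)
            \<le> enn_powr (ennreal (h x powr (q / p) * c1)) (p / q)"
            using elim xQ p q by (intro enn_powr_mono inner) auto
          also have "\<dots> = ennreal ((h x powr (q / p) * c1) powr (p / q))"
            using c1 by (simp add: enn_powr_ennreal)
          \<comment> \<open>The outer exponent p/q undoes q/p, so only the plain average of
            \<open>g\<close> remains, which the reducing matrix controls.\<close>
          also have "(h x powr (q / p) * c1) powr (p / q) = h x * c1 powr (p / q)"
            using h c1 p q by (simp add: powr_mult powr_powr)
          also have "\<dots> = K * g x" by (simp add: h_def K_def mult_ac)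
          finally show "enn_powr (average Q (\<lambda>y. ennreal (op_norm (V x ** matrix_inv (V y)) powr q))) (p / q)
              \<le> ennreal K * ennreal (g x)"
            using K by (simp add: ennreal_mult')
        qed
      qed
    qed
    also have "\<dots> \<le> ennreal K * average Q (\<lambda>x. ennreal (g x))"
      by (rule average_cmult_le[OF K])
    also have "\<dots> \<le> ennreal K * ennreal d"
      using avgE by (intro mult_left_mono) (auto simp: g_def d_def)
    also have "\<dots> = ennreal (K * d)" using K by (simp add: ennreal_mult')
    finally have "enn_powr (average Q (\<lambda>x. enn_powr
        (average Q (\<lambda>y. ennreal (op_norm (V x ** matrix_inv (V y)) powr q))) (p / q))) (1 / p)
      \<le> enn_powr (ennreal (K * d)) (1 / p)"
      using p by (intro enn_powr_mono) auto
    also have "\<dots> = ennreal ((K * d) powr (1 / p))"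
      using K by (intro enn_powr_ennreal) (simp add: d_def)
    finally show ?thesis .
  qed
  then have "Ap_const p V \<le> ennreal ((K * d) powr (1 / p))"
    unfolding Ap_const_def q_def by (intro SUP_least)
  then have "Ap_const p V < \<infinity>" by (simp add: order_le_less_trans)
  moreover have "matrix_weight V"
    unfolding V_def by (rule matrix_weight_geom_mean[OF W0 W1])
  ultimately have "V \<in> class_Ap p" by (simp add: class_Ap_def)
  then show ?thesis unfolding V_def t_def q_def .
qed

theorem proposition8p7:
  fixes W0 W1 :: "real^'n \<Rightarrow> real^'d^'d" and p :: real
  assumes "W0 \<in> class_A1" and "W1 \<in> class_Ainf" and "1 < p"
  shows "(\<lambda>x. mat_powr (geom_mean (1 / conj_exp p) (W0 x ** W0 x) (W1 x ** W1 x)) (1/2))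
           \<in> class_Ap p \<and>
         ((\<forall>x. W0 x ** W1 x = W1 x ** W0 x) \<longrightarrow>
           (\<lambda>x. mat_powr (W0 x) (1 / p) ** mat_powr (W1 x) (1 / conj_exp p)) \<in> class_Ap p)"
proof (intro conjI impI)
  show *: "(\<lambda>x. mat_powr (geom_mean (1 / conj_exp p) (W0 x ** W0 x) (W1 x ** W1 x)) (1/2)) \<in> class_Ap p"
    by (rule geom_mean_in_class_Ap[OF assms])
  assume comm: "\<forall>x. W0 x ** W1 x = W1 x ** W0 x"
  have psd: "pos_semidef (W0 x)" "pos_semidef (W1 x)" for x
    using assms(1,2) by (auto simp: class_A1_def class_Ainf_def matrix_weight_def)
  have "1 - 1 / conj_exp p = 1 / p" using conj_exp[OF assms(3)] by simp
  then have "mat_powr (geom_mean (1 / conj_exp p) (W0 x ** W0 x) (W1 x ** W1 x)) (1/2)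
      = mat_powr (W0 x) (1 / p) ** mat_powr (W1 x) (1 / conj_exp p)" for x
    using mat_powr_half_geom_mean_commuting[OF psd(1)[of x] psd(2)[of x], of "1 / conj_exp p"] comm by simp
  then show "(\<lambda>x. mat_powr (W0 x) (1 / p) ** mat_powr (W1 x) (1 / conj_exp p)) \<in> class_Ap p"
    using * by simp
qed

end
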